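(* Let $K$ be a non-Archimedean local field with ring of integers $O$ and residue field cardinality $q$, let $\mathcal H\subset L^2(O)$ be the subspace of radial functions, and let $I_0^1$ be the Volterra operator in $\mathcal H$ given by $$ (I_0^1 u)(x)=\frac{1-q}{q\log q}\int\limits_{|y|_K<|x|_K}\left(\log|x|_K-\log|y|_K\right)u(|y|_K)\,dy ,\qquad x\in O . $$ Let $h_1(|x|_K)=\dfrac{q-1}{iq\log q}$ (a constant function), $h_2(|x|_K)=\log|x|_K$, $x\in O$, and $j=\begin{pmatrix}0&1\\1&0\end{pmatrix}$, and let $$ W(z^{-1})=E+izj\left[\left\langle (E-zI_0^1)^{-1}h_\alpha,h_\beta\right\rangle\right]_{\alpha,\beta=1}^2 $$ be the $2\times2$ characteristic matrix-function of inverse argument of $I_0^1$. Then the matrix elements of $W(z^{-1})$ are entire functions of $z$ of zero order.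
   Context: $K$ is a non-Archimedean local field (a non-discrete totally disconnected locally compact topological field) with absolute value $|\cdot|_K$, $O=\{x\in K:|x|_K\le 1\}$, $P=\{x\in K:|x|_K<1\}$, $q$ is the cardinality of the finite field $O/P$. The absolute value is normalized: its nonzero values are exactly $q^N$, $N\in\mathbb Z$. $dx$ is the Haar measure on the additive group of $K$ with $\int_O dx=1$. $\mathcal H$ is the subspace of $L^2(O)$ (complex-valued functions) consisting of radial functions, i.e. functions depending only on $|x|_K$; $\langle\cdot,\cdot\rangle$ is its inner product, linear in the first argument. $E$ denotes both the unit operator in $\mathcal H$ and the $2\times2$ unit matrix. A compact operator is called a Volterra operator if its spectrum is $\{0\}$. The functions $h_1,h_2$ and the matrix $j=(j_{\alpha\beta})$ are such that $$ \frac1i\left(I_0^1-(I_0^1)^*\right)u=\sum_{\alpha,\beta=1}^2\langle u,h_\alpha\rangle j_{\alpha\beta}h_\beta,\qquad u\in\mathcal H . $$ *)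

theory Defs
  imports "HOL-Analysis.Analysis"
begin

definition ring_of_integers :: "('a::field \<Rightarrow> real) \<Rightarrow> 'a set" where
  "ring_of_integers absK = {x. absK x \<le> 1}"

definition maximal_ideal :: "('a::field \<Rightarrow> real) \<Rightarrow> 'a set" where
  "maximal_ideal absK = {x. absK x < 1}"

text \<open>The additive cosets \<open>x + P\<close> with \<open>x \<in> O\<close>, that is, the elements of \<open>O/P\<close>.\<close>

definition residue_classes :: "('a::field \<Rightarrow> real) \<Rightarrow> 'a set set" where
  "residue_classes absK = (\<lambda>x. (+) x ` maximal_ideal absK) ` ring_of_integers absK"

definition residue_card :: "('a::field \<Rightarrow> real) \<Rightarrow> nat" where
  "residue_card absK = card (residue_classes absK)"

text \<open>
  The sort constraints make the ring operations continuous and the topology Hausdorff.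
  The topology is the one induced by the normalized absolute value \<open>absK\<close>.
\<close>

locale nonarch_local_field =
  fixes absK :: "'a::{field, t2_space, topological_ab_group_add, topological_semigroup_mult} \<Rightarrow> real"
  assumes continuous_inverse: "continuous_on (- {0::'a}) inverse"
    and nondiscrete: "\<exists>S::'a set. \<not> open S"
    and totally_disconnected: "\<And>S::'a set. connected S \<Longrightarrow> \<exists>x. S \<subseteq> {x}"
    and locally_compact: "locally_compact_space (euclidean :: 'a topology)"
    and abs_nonneg: "\<And>x. 0 \<le> absK x"
    and abs_eq_0_iff: "\<And>x. absK x = 0 \<longleftrightarrow> x = 0"
    and abs_mult: "\<And>x y. absK (x * y) = absK x * absK y"
    and abs_ultrametric: "\<And>x y. absK (x + y) \<le> max (absK x) (absK y)"
    and open_iff_abs: "\<And>S. open S \<longleftrightarrow> (\<forall>x\<in>S. \<exists>e>0. \<forall>y. absK (y - x) < e \<longrightarrow> y \<in> S)"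
    and finite_residue_classes: "finite (residue_classes absK)"
    and abs_normalized:
      "absK ` (- {0}) = range (\<lambda>N::int. real (residue_card absK) powi N)"

text \<open>Haar measure on the additive group, normalized by \<open>\<mu>(O) = 1\<close>.\<close>

locale normalized_haar_measure =
  fixes absK :: "'a::{field, topological_space} \<Rightarrow> real" and \<mu> :: "'a measure"
  assumes sets_haar: "sets \<mu> = sets borel"
    and translation_invariant:
      "\<And>a A. A \<in> sets borel \<Longrightarrow> emeasure \<mu> ((+) a ` A) = emeasure \<mu> A"
    and finite_on_compact: "\<And>C. compact C \<Longrightarrow> emeasure \<mu> C < \<infinity>"
    and outer_regular:
      "\<And>A. A \<in> sets borel \<Longrightarrow> emeasure \<mu> A = (INF U\<in>{U. A \<subseteq> U \<and> open U}. emeasure \<mu> U)"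
    and inner_regular_open:
      "\<And>U. open U \<Longrightarrow> emeasure \<mu> U = (SUP C\<in>{C. C \<subseteq> U \<and> compact C}. emeasure \<mu> C)"
    and haar_integers: "emeasure \<mu> (ring_of_integers absK) = 1"

text \<open>
  \<open>L\<^sup>2(M)\<close> is represented by functions; two functions represent the same vector iff they
  are equal almost everywhere. Statements about vectors below are therefore made up to
  \<open>l2_eq\<close>.
\<close>

definition L2 :: "'a measure \<Rightarrow> ('a \<Rightarrow> complex) set" where
  "L2 M = {u \<in> borel_measurable M. integrable M (\<lambda>x. (cmod (u x))\<^sup>2)}"

definition l2_eq :: "'a measure \<Rightarrow> ('a \<Rightarrow> complex) \<Rightarrow> ('a \<Rightarrow> complex) \<Rightarrow> bool" where
  "l2_eq M u v \<longleftrightarrow> (AE x in M. u x = v x)"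

definition l2_inner :: "'a measure \<Rightarrow> ('a \<Rightarrow> complex) \<Rightarrow> ('a \<Rightarrow> complex) \<Rightarrow> complex" where
  "l2_inner M u v = (LINT x|M. u x * cnj (v x))"

definition l2_norm :: "'a measure \<Rightarrow> ('a \<Rightarrow> complex) \<Rightarrow> real" where
  "l2_norm M u = sqrt (LINT x|M. (cmod (u x))\<^sup>2)"

text \<open>\<open>l2_bounded_op M H T\<close>: \<open>T\<close> represents a bounded linear operator on the subspace \<open>H\<close> of
  \<open>L\<^sup>2(M)\<close>. Linearity and boundedness imply that \<open>T\<close> respects \<open>l2_eq M\<close>.\<close>

definition l2_bounded_op ::
  "'a measure \<Rightarrow> ('a \<Rightarrow> complex) set \<Rightarrow> (('a \<Rightarrow> complex) \<Rightarrow> ('a \<Rightarrow> complex)) \<Rightarrow> bool" where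
  "l2_bounded_op M H T \<longleftrightarrow>
     (\<forall>u\<in>H. T u \<in> H) \<and>
     (\<forall>u\<in>H. \<forall>v\<in>H. \<forall>a b. l2_eq M (T (\<lambda>x. a * u x + b * v x)) (\<lambda>x. a * T u x + b * T v x)) \<and>
     (\<exists>C. \<forall>u\<in>H. l2_norm M (T u) \<le> C * l2_norm M u)"

definition is_inverse_op ::
  "'a measure \<Rightarrow> ('a \<Rightarrow> complex) set \<Rightarrow> (('a \<Rightarrow> complex) \<Rightarrow> ('a \<Rightarrow> complex)) \<Rightarrow>
   (('a \<Rightarrow> complex) \<Rightarrow> ('a \<Rightarrow> complex)) \<Rightarrow> bool" where
  "is_inverse_op M H T R \<longleftrightarrow>
     l2_bounded_op M H R \<and> (\<forall>u\<in>H. l2_eq M (T (R u)) u \<and> l2_eq M (R (T u)) u)"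

text \<open>The inverse is determined up to \<open>l2_eq M\<close>; the choice only concerns representatives.\<close>

definition inverse_op ::
  "'a measure \<Rightarrow> ('a \<Rightarrow> complex) set \<Rightarrow> (('a \<Rightarrow> complex) \<Rightarrow> ('a \<Rightarrow> complex)) \<Rightarrow>
   (('a \<Rightarrow> complex) \<Rightarrow> ('a \<Rightarrow> complex))" where
  "inverse_op M H T = (SOME R. is_inverse_op M H T R)"

definition char_matrix_inv ::
  "'a measure \<Rightarrow> ('a \<Rightarrow> complex) set \<Rightarrow> (('a \<Rightarrow> complex) \<Rightarrow> ('a \<Rightarrow> complex)) \<Rightarrow>
   (2 \<Rightarrow> 'a \<Rightarrow> complex) \<Rightarrow> complex^2^2 \<Rightarrow> complex \<Rightarrow> complex^2^2" where
  "char_matrix_inv M H T h j z =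
     (let R = inverse_op M H (\<lambda>u x. u x - z * T u x);
          G = (\<chi> \<alpha> \<beta>. l2_inner M (R (h \<alpha>)) (h \<beta>)) :: complex^2^2
      in mat 1 + (\<chi> \<alpha> \<beta>. \<i> * z * (j ** G) $ \<alpha> $ \<beta>))"

definition integers_measure :: "('a::field \<Rightarrow> real) \<Rightarrow> 'a measure \<Rightarrow> 'a measure" where
  "integers_measure absK \<mu> = restrict_space \<mu> (ring_of_integers absK)"

definition radial_L2 :: "('a::field \<Rightarrow> real) \<Rightarrow> 'a measure \<Rightarrow> ('a \<Rightarrow> complex) set" where
  "radial_L2 absK \<mu> =
     {u \<in> L2 (integers_measure absK \<mu>).
        \<exists>f::real \<Rightarrow> complex. l2_eq (integers_measure absK \<mu>) u (\<lambda>x. f (absK x))}"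

definition volterra_I ::
  "('a::field \<Rightarrow> real) \<Rightarrow> 'a measure \<Rightarrow> ('a \<Rightarrow> complex) \<Rightarrow> ('a \<Rightarrow> complex)" where
  "volterra_I absK \<mu> u x =
     (let q = real (residue_card absK) in
       complex_of_real ((1 - q) / (q * ln q)) *
       (LINT y:{y. absK y < absK x}|\<mu>. complex_of_real (ln (absK x) - ln (absK y)) * u y))"

text \<open>The value of \<open>h\<^sub>2\<close> at \<open>0\<close> is irrelevant because \<open>{0}\<close> is a null set.\<close>

definition channel_fun :: "('a::field \<Rightarrow> real) \<Rightarrow> 2 \<Rightarrow> 'a \<Rightarrow> complex" where
  "channel_fun absK \<alpha> x =
     (let q = real (residue_card absK) in
       if \<alpha> = 1 then complex_of_real (q - 1) / (\<i> * complex_of_real (q * ln q))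
       else complex_of_real (ln (absK x)))"

definition channel_matrix :: "complex^2^2" where
  "channel_matrix = vector [vector [0, 1], vector [1, 0]]"

definition max_modulus :: "(complex \<Rightarrow> complex) \<Rightarrow> real \<Rightarrow> real" where
  "max_modulus f r = (SUP z\<in>sphere 0 r. cmod (f z))"

text \<open>The order of an entire function: the greatest lower bound of the exponents \<open>a > 0\<close> with
  \<open>M\<^sub>f(r) < exp(r\<^sup>a)\<close> for all large \<open>r\<close>. It equals the upper limit of
  \<open>log log M\<^sub>f(r) / log r\<close> for nonconstant \<open>f\<close> and is \<open>0\<close> for constants.\<close>

definition entire_order :: "(complex \<Rightarrow> complex) \<Rightarrow> ereal" where
  "entire_order f =
     Inf (ereal ` {a. a > 0 \<and> (\<forall>\<^sub>F r in at_top. max_modulus f r < exp (r powr a))})"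

end

theory Submission
  imports Defs "HOL-Real_Asymp.Real_Asymp"
begin

text \<open>
  The sphere \<open>\<bar>x\<bar> = r\<^sup>n\<close> with \<open>r = 1/q\<close> has Haar measure \<open>(1 - r) r\<^sup>n\<close>, so a radial function is a sequence
  \<open>f\<close> and the Volterra operator becomes \<open>-(1 - r)\<^sup>2 B\<close> with \<open>(B f) n = \<Sum>m>n. (m - n) r\<^sup>m f m\<close>. Each
  application of \<open>B\<close> gains a factor \<open>r\<^sup>n\<close> of decay in \<open>n\<close>, and summing this gain gives
  \<open>\<bar>(B\<^sup>k f) n\<bar> \<le> A C\<^sup>k s\<^bsup>k\<^sup>2\<^esup> s\<^bsup>(2k - 1)n\<^esup>\<close> with \<open>s = \<surd>r\<close>. Hence the Neumann series of the resolvent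
  converges for every \<open>z\<close>, and the entries of the characteristic matrix are power series in \<open>z\<close> with
  coefficients of size \<open>D\<^sup>k s\<^bsup>k\<^sup>2\<^esup>\<close>. Their maximum modulus is at most of order \<open>exp (c ln\<^sup>2 \<bar>z\<bar>)\<close>.
\<close>

section \<open>Power series with Gaussian coefficients\<close>

text \<open>A product of two summable sequences is summable over pairs, so the majorant makes the
  double family absolutely summable and Fubini for \<open>infsum\<close> applies. Summability of the
  partial sums then identifies each \<open>infsum\<close> with the ordinary series.\<close>

lemma suminf_swap_product_bound:
  fixes a :: "nat \<Rightarrow> nat \<Rightarrow> 'b::banach"
  assumes bound: "\<And>m k. norm (a m k) \<le> \<alpha> m * \<beta> k"
    and "summable \<alpha>" "summable \<beta>" "\<And>m. 0 \<le> \<alpha> m" "\<And>k. 0 \<le> \<beta> k"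
  shows "(\<Sum>m. \<Sum>k. a m k) = (\<Sum>k. \<Sum>m. a m k)"
proof -
  have A: "\<alpha> summable_on UNIV" and B: "\<beta> summable_on UNIV"
    using assms by (auto intro!: summable_nonneg_imp_summable_on)
  have inner1: "summable (\<lambda>k. norm (a m k))" for m
    by (rule summable_comparison_test'[of "\<lambda>k. \<alpha> m * \<beta> k"])
      (use bound assms in \<open>auto intro: summable_mult\<close>)
  have inner2: "summable (\<lambda>m. norm (a m k))" for k
    by (rule summable_comparison_test'[of "\<lambda>m. \<alpha> m * \<beta> k"])
      (use bound assms in \<open>auto intro: summable_mult2\<close>)
  have inner1': "(\<lambda>k. a m k) summable_on UNIV" for m
    by (rule norm_summable_imp_summable_on[OF inner1])
  have inner2': "(\<lambda>m. a m k) summable_on UNIV" for k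
    by (rule norm_summable_imp_summable_on[OF inner2])
  have "(\<lambda>p. norm (case p of (m, k) \<Rightarrow> \<alpha> m * \<beta> k)) summable_on UNIV \<times> UNIV"
    unfolding Infinite_Sum.abs_summable_on_Sigma_iff using A B assms
    by (auto simp: abs_mult infsum_cmult_right' infsum_nonneg
      intro!: summable_on_cmult_right summable_on_cmult_left)
  then have prod: "(\<lambda>(m, k). \<alpha> m * \<beta> k) summable_on UNIV \<times> UNIV"
    by (rule abs_summable_summable)
  have abs: "(\<lambda>p. norm (case p of (m, k) \<Rightarrow> a m k)) summable_on UNIV \<times> UNIV"
    by (rule summable_on_comparison_test[OF prod]) (use bound in auto)
  then have joint: "(\<lambda>(m, k). a m k) summable_on UNIV \<times> UNIV"
    by (rule abs_summable_summable)
  have joint': "(\<lambda>(k, m). a m k) summable_on UNIV \<times> UNIV"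
    using joint summable_on_swap[of "\<lambda>(m, k). a m k" UNIV UNIV] by auto
  have "(\<lambda>m. infsum (\<lambda>k. a m k) UNIV) summable_on UNIV"
    using summable_on_Sigma_banach[OF joint] by simp
  moreover have "(\<lambda>k. infsum (\<lambda>m. a m k) UNIV) summable_on UNIV"
    using summable_on_Sigma_banach[OF joint'] by simp
  moreover have "infsum (\<lambda>m. infsum (\<lambda>k. a m k) UNIV) UNIV
      = infsum (\<lambda>k. infsum (\<lambda>m. a m k) UNIV) UNIV"
    by (rule infsum_swap_banach[OF joint])
  moreover have "infsum f UNIV = suminf f" if "f summable_on UNIV" for f :: "nat \<Rightarrow> 'b"
    using has_sum_imp_sums[OF has_sum_infsum[OF that]] by (simp add: sums_iff)
  ultimately show ?thesis
    by (simp add: inner1' inner2')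
qed

lemma sums_of_nat_power:
  fixes t :: real
  assumes "0 \<le> t" "t < 1"
  shows "(\<lambda>d. real d * t ^ d) sums (t / (1 - t)\<^sup>2)"
proof -
  have "(\<lambda>d. t * (real (Suc d) * t ^ d)) sums (t * (1 / (1 - t)\<^sup>2))"
    by (intro sums_mult geometric_deriv_sums) (use assms in auto)
  then have "(\<lambda>d. real (Suc d) * t ^ Suc d) sums (t / (1 - t)\<^sup>2)"
    by (simp add: mult_ac)
  then show ?thesis
    by (subst (asm) sums_Suc_iff) simp
qed

text \<open>Truncated subtraction annihilates the terms with m \<le> n, so the substitution m = d +
  n leaves the series for d t^d times t^n. This evaluates the kernel of the Volterra operator
  against geometric decay.\<close>

lemma sums_shifted_of_nat_power:
  fixes t :: real
  assumes "0 \<le> t" "t < 1"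
  shows "(\<lambda>m. real (m - n) * t ^ m) sums (t ^ n * (t / (1 - t)\<^sup>2))"
proof -
  have "(\<lambda>d. t ^ n * (real d * t ^ d)) sums (t ^ n * (t / (1 - t)\<^sup>2))"
    by (intro sums_mult sums_of_nat_power assms)
  then have "(\<lambda>d. real (d + n - n) * t ^ (d + n)) sums (t ^ n * (t / (1 - t)\<^sup>2))"
    by (simp add: power_add mult_ac)
  then show ?thesis
    by (subst (asm) sums_zero_iff_shift[where f = "\<lambda>m. real (m - n) * t ^ m"]) auto
qed

text \<open>Completing the square in \<open>k ln x - k\<^sup>2 ln (1/s)\<close>.\<close>

lemma power_times_gaussian_le:
  fixes x s :: real
  assumes "0 < x" "0 < s" "s < 1"
  shows "x ^ k * s ^ (k\<^sup>2) \<le> exp ((ln x)\<^sup>2 / (4 * ln (1 / s)))"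
proof -
  define \<sigma> where "\<sigma> = ln (1 / s)"
  have \<sigma>: "\<sigma> > 0" and s: "s = exp (- \<sigma>)"
    using assms by (auto simp: \<sigma>_def ln_div)
  have "x ^ k * s ^ (k\<^sup>2) = exp (k * ln x) * exp (- (real k)\<^sup>2 * \<sigma>)"
    using assms by (simp add: s exp_of_nat_mult flip: exp_of_nat_mult[of "k\<^sup>2" "- \<sigma>", simplified])
  also have "\<dots> = exp (k * ln x - (real k)\<^sup>2 * \<sigma>)"
    by (simp add: exp_add[symmetric])
  also have "\<dots> \<le> exp ((ln x)\<^sup>2 / (4 * \<sigma>))"
  proof -
    have "0 \<le> (2 * \<sigma> * k - ln x)\<^sup>2"
      by simp
    then have "(k * ln x - (real k)\<^sup>2 * \<sigma>) * (4 * \<sigma>) \<le> (ln x)\<^sup>2"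
      by (simp add: power2_eq_square algebra_simps)
    then show ?thesis
      using \<sigma> by (simp add: pos_le_divide_eq)
  qed
  finally show ?thesis
    by (simp add: \<sigma>_def)
qed

text \<open>Writing x^k = (2x)^k (1/2)^k, the square completion bounds (2x)^k s^(k^2) uniformly in
  k, and the remaining geometric series has sum 2.\<close>

lemma gaussian_series:
  fixes x s :: real
  assumes "0 < x" "0 < s" "s < 1"
  shows "summable (\<lambda>k. x ^ k * s ^ (k\<^sup>2))"
    and "(\<Sum>k. x ^ k * s ^ (k\<^sup>2)) \<le> 2 * exp ((ln (2 * x))\<^sup>2 / (4 * ln (1 / s)))"
proof -
  define E where "E = exp ((ln (2 * x))\<^sup>2 / (4 * ln (1 / s)))"
  have le: "x ^ k * s ^ (k\<^sup>2) \<le> E * (1 / 2) ^ k" for k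
  proof -
    have "x ^ k * s ^ (k\<^sup>2) = ((2 * x) ^ k * s ^ (k\<^sup>2)) * (1 / 2) ^ k"
      by (simp add: power_mult_distrib power_divide)
    also have "\<dots> \<le> E * (1 / 2) ^ k"
      unfolding E_def by (intro mult_right_mono power_times_gaussian_le) (use assms in auto)
    finally show ?thesis .
  qed
  have geo: "(\<lambda>k. E * (1 / 2) ^ k) sums (2 * E)"
    using sums_mult[OF geometric_sums[of "1 / 2 :: real"], of E] by (simp add: mult_ac)
  show sm: "summable (\<lambda>k. x ^ k * s ^ (k\<^sup>2))"
    by (rule summable_comparison_test'[OF sums_summable[OF geo]]) (use le assms in auto)
  show "(\<Sum>k. x ^ k * s ^ (k\<^sup>2)) \<le> 2 * exp ((ln (2 * x))\<^sup>2 / (4 * ln (1 / s)))"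
    using suminf_le[OF le sm sums_summable[OF geo]] sums_unique[OF geo] by (simp add: E_def)
qed

text \<open>Under the hypothesis the admissible exponents are exactly the positive reals, whose
  infimum is 0.\<close>

lemma entire_order_eq_0I:
  assumes "\<And>a. a > 0 \<Longrightarrow> \<forall>\<^sub>F r in at_top. max_modulus f r < exp (r powr a)"
  shows "entire_order f = 0"
proof -
  have "{a. a > 0 \<and> (\<forall>\<^sub>F r in at_top. max_modulus f r < exp (r powr a))} = {0<..}"
    using assms by auto
  moreover have "Inf (ereal ` {0<..}) = 0"
  proof (rule antisym)
    show "Inf (ereal ` {0<..}) \<le> 0"
    proof (rule ereal_le_epsilon2)
      fix e :: real assume "0 < e"
      then show "Inf (ereal ` {0<..}) \<le> 0 + ereal e"
        by (auto intro: Inf_lower)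
    qed
    show "0 \<le> Inf (ereal ` {0<..})"
      by (rule Inf_greatest) auto
  qed
  ultimately show ?thesis
    by (simp add: entire_order_def)
qed

text \<open>On the circle of radius r the series is dominated by the Gaussian series at D r, which
  gives convergence everywhere and a maximum modulus of order r exp(c ln^2 r). The prescribed shape
  of f is that of an entry of the characteristic matrix.\<close>

lemma gaussian_coefficients_entire_order_0:
  fixes c :: "nat \<Rightarrow> complex" and d :: complex
  assumes c: "\<And>k. cmod (c k) \<le> A * D ^ k * s ^ (k\<^sup>2)"
    and "0 < D" "0 < s" "s < 1" "0 \<le> A"
    and f: "\<And>z. f z = d + \<i> * z * (\<Sum>k. c k * z ^ k)"
  shows "f holomorphic_on UNIV" and "entire_order f = 0"
proof -
  have le: "cmod (c k * z ^ k) \<le> A * ((D * r) ^ k * s ^ (k\<^sup>2))" if "cmod z \<le> r" for z k r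
  proof -
    have "cmod (c k * z ^ k) \<le> (A * D ^ k * s ^ (k\<^sup>2)) * r ^ k"
      unfolding norm_mult norm_power
      by (intro mult_mono c power_mono that) (use assms in auto)
    then show ?thesis
      by (simp add: power_mult_distrib mult_ac)
  qed
  have sm: "summable (\<lambda>k. A * ((D * r) ^ k * s ^ (k\<^sup>2)))" if "r > 0" for r
    by (intro summable_mult gaussian_series) (use assms that in auto)
  \<comment> \<open>The comparison radius \<open>cmod z + 1\<close> is positive even for z = 0, as
    the Gaussian estimate demands.\<close>
  have smz: "summable (\<lambda>k. c k * z ^ k)" for z
    by (rule summable_comparison_test'[OF sm[of "cmod z + 1"] le])
      (auto simp: add_nonneg_pos)
  have "f field_differentiable at z" for z
  proof -
    have "((\<lambda>z. \<Sum>k. c k * z ^ k) has_field_derivative (\<Sum>k. diffs c k * z ^ k)) (at z)"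
      by (rule termdiffs_strong_converges_everywhere) (rule smz)
    then have "(\<lambda>z. \<Sum>k. c k * z ^ k) field_differentiable at z"
      by (auto simp: field_differentiable_def)
    then have "(\<lambda>z. d + \<i> * z * (\<Sum>k. c k * z ^ k)) field_differentiable at z"
      by (intro derivative_intros)
    then show ?thesis
      using f by presburger
  qed
  then show "f holomorphic_on UNIV"
    by (auto simp: holomorphic_on_def)
  define \<sigma> where "\<sigma> = ln (1 / s)"
  have \<sigma>: "\<sigma> > 0"
    using assms by (auto simp: \<sigma>_def ln_div)
  have M: "max_modulus f r \<le> cmod d + r * (A * (2 * exp ((ln (2 * (D * r)))\<^sup>2 / (4 * \<sigma>))))"
    if r: "r > 0" for r
    unfolding max_modulus_def
  proof (rule cSUP_least)
    show "sphere (0::complex) r \<noteq> {}"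
      using r by simp
    fix z :: complex assume z: "z \<in> sphere 0 r"
    have "cmod (\<Sum>k. c k * z ^ k) \<le> (\<Sum>k. A * ((D * r) ^ k * s ^ (k\<^sup>2)))"
      by (rule norm_suminf_le) (use le sm z r in auto)
    also have "\<dots> = A * (\<Sum>k. (D * r) ^ k * s ^ (k\<^sup>2))"
      by (intro suminf_mult gaussian_series) (use assms r in auto)
    also have "\<dots> \<le> A * (2 * exp ((ln (2 * (D * r)))\<^sup>2 / (4 * \<sigma>)))"
      unfolding \<sigma>_def by (intro mult_left_mono gaussian_series) (use assms r in auto)
    finally have "r * cmod (\<Sum>k. c k * z ^ k)
        \<le> r * (A * (2 * exp ((ln (2 * (D * r)))\<^sup>2 / (4 * \<sigma>))))"
      using r by simp
    moreover have "cmod (f z) \<le> cmod d + r * cmod (\<Sum>k. c k * z ^ k)"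
      unfolding f by (rule order_trans[OF norm_triangle_ineq]) (use z in \<open>simp add: norm_mult\<close>)
    ultimately show "cmod (f z) \<le> cmod d + r * (A * (2 * exp ((ln (2 * (D * r)))\<^sup>2 / (4 * \<sigma>))))"
      by linarith
  qed
  show "entire_order f = 0"
  proof (rule entire_order_eq_0I)
    fix a :: real assume "a > 0"
    \<comment> \<open>The squared logarithm in the exponent, like the logarithm of the factor r,
      grows more slowly than any positive power of r.\<close>
    then have "\<forall>\<^sub>F r in at_top. cmod d + r * (A * (2 * exp ((ln (2 * (D * r)))\<^sup>2 / (4 * \<sigma>))))
        < exp (r powr a)"
      using \<open>0 < D\<close> \<sigma> \<open>0 \<le> A\<close> by real_asymp
    then show "\<forall>\<^sub>F r in at_top. max_modulus f r < exp (r powr a)"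
      using eventually_gt_at_top[of 0] by eventually_elim (use M in fastforce)
  qed
qed

section \<open>The Volterra operator on sequences\<close>

text \<open>Truncated subtraction makes the terms with m \<le> n vanish, so the full series is a sum
  over the spheres of smaller radius. The weight \<open>r ^ m\<close> is the Haar mass of a sphere
  up to the factor 1 - r.\<close>

definition volt_seq :: "real \<Rightarrow> (nat \<Rightarrow> complex) \<Rightarrow> nat \<Rightarrow> complex" where
  "volt_seq r f n = (\<Sum>m. of_nat (m - n) * of_real (r ^ m) * f m)"

text \<open>The Neumann series of (E - z B)^(-1) with B = \<open>volt_seq r\<close>, taken pointwise
  in n.\<close>

definition resolvent_seq :: "real \<Rightarrow> complex \<Rightarrow> (nat \<Rightarrow> complex) \<Rightarrow> nat \<Rightarrow> complex" where
  "resolvent_seq r z f n = (\<Sum>k. z ^ k * (volt_seq r ^^ k) f n)"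

text \<open>The weight r^n is split into two factors s^n: one compensates the growth of a
  square-summable sequence, the other is left to produce decay.\<close>

locale volterra_sequences =
  fixes s r :: real
  assumes s: "0 < s" "s < 1" and r_eq: "r = s\<^sup>2"
begin

lemma r: "0 < r" "r < 1"
  using s by (auto simp: r_eq power_less_one_iff)

text \<open>Bounds 1 / (1 - t)^2 for all the ratios t = s^(2k+1) at once, since each of them is at
  most s.\<close>

definition C :: real where "C = 1 / (1 - s)\<^sup>2"

lemma C_pos: "C > 0"
  using s by (simp add: C_def)

text \<open>Growth at most s^(-n). Every square-summable sequence satisfies such a bound, and it is
  preserved by the Volterra operator and its resolvent.\<close>

definition bounded_by :: "real \<Rightarrow> (nat \<Rightarrow> complex) \<Rightarrow> bool" where
  "bounded_by A f \<longleftrightarrow> (\<forall>n. cmod (f n) * s ^ n \<le> A)"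

lemma bounded_by_nonneg: "bounded_by A f \<Longrightarrow> 0 \<le> A"
  unfolding bounded_by_def using s by (metis mult_nonneg_nonneg norm_ge_zero order_trans less_imp_le zero_le_power)

text \<open>Of the two factors in r^m = s^m s^m, one normalizes f m and the other joins the assumed
  decay s^(2km), so that the kernel is summed against powers of s^(2k+1).\<close>

lemma volt_seq_term_bound:
  assumes "\<And>n. cmod (f n) * s ^ n \<le> A * s ^ (2 * k * n)"
  shows "cmod (of_nat (m - n) * of_real (r ^ m) * f m) \<le> A * (real (m - n) * (s ^ (2 * k + 1)) ^ m)"
proof -
  have "cmod (of_nat (m - n) * of_real (r ^ m) * f m) = real (m - n) * s ^ m * (cmod (f m) * s ^ m)"
    using s by (simp add: norm_mult norm_power r_eq power2_eq_square power_mult_distrib mult_ac)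
  also have "\<dots> \<le> real (m - n) * s ^ m * (A * s ^ (2 * k * m))"
    using s by (intro mult_left_mono assms) auto
  also have "\<dots> = A * (real (m - n) * (s ^ (2 * k + 1)) ^ m)"
    by (simp add: power_add algebra_simps flip: power_mult)
  finally show ?thesis .
qed

lemma volt_seq_summable:
  assumes "bounded_by A f"
  shows "summable (\<lambda>m. cmod (of_nat (m - n) * of_real (r ^ m) * f m))"
  by (rule summable_comparison_test'[of "\<lambda>m. A * (real (m - n) * (s ^ (2 * 0 + 1)) ^ m)"])
    (use assms volt_seq_term_bound[of f A 0] s in
      \<open>auto simp: bounded_by_def intro!: summable_mult sums_summable[OF sums_shifted_of_nat_power]\<close>)

text \<open>With t = s^(2k+1) the kernel sums to t^n t / (1 - t)^2. The factor t^n s^n = s^(2(k+1)n)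
  raises the decay exponent from 2k to 2(k+1), and the extra t is the constant gained in this
  application.\<close>

lemma volt_seq_bound:
  assumes f: "\<And>n. cmod (f n) * s ^ n \<le> A * s ^ (2 * k * n)" and A: "0 \<le> A"
  shows "cmod (volt_seq r f n) * s ^ n \<le> A * C * s ^ (2 * k + 1) * s ^ (2 * Suc k * n)"
proof -
  define t where "t = s ^ (2 * k + 1)"
  have t: "0 \<le> t" "t \<le> s"
    using s power_decreasing[of 1 "2 * k + 1" s] by (auto simp: t_def)
  have sums: "(\<lambda>m. A * (real (m - n) * t ^ m)) sums (A * (t ^ n * (t / (1 - t)\<^sup>2)))"
    by (intro sums_mult sums_shifted_of_nat_power) (use t s in auto)
  have "cmod (volt_seq r f n) \<le> A * (t ^ n * (t / (1 - t)\<^sup>2))"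
    unfolding volt_seq_def sums_unique[OF sums]
    by (rule norm_suminf_le) (use volt_seq_term_bound[OF f] sums in \<open>auto simp: sums_iff t_def\<close>)
  also have "t / (1 - t)\<^sup>2 \<le> t * C"
    unfolding C_def using t s frac_le[of t t "(1 - s)\<^sup>2" "(1 - t)\<^sup>2"] by (simp add: power_mono)
  then have "A * (t ^ n * (t / (1 - t)\<^sup>2)) \<le> A * (t ^ n * (t * C))"
    using A t by (intro mult_left_mono) auto
  finally have "cmod (volt_seq r f n) * s ^ n \<le> (A * (t ^ n * (t * C))) * s ^ n"
    using s by (intro mult_right_mono) auto
  also have "t ^ n * s ^ n = s ^ (2 * Suc k * n)"
    by (simp add: t_def power_mult power_mult_distrib power_add power2_eq_square mult_ac)
  then have "(A * (t ^ n * (t * C))) * s ^ n = A * C * t * s ^ (2 * Suc k * n)"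
    by (simp add: mult_ac)
  finally show ?thesis
    by (simp add: t_def)
qed

text \<open>The successive applications gain s, s^3, ..., s^(2k-1). Since 1 + 3 + ... + (2k-1) =
  k^2, these multiply to the Gaussian factor, which is the source of both convergence for every z
  and zero order.\<close>

lemma volt_seq_power_bound:
  assumes "bounded_by A f"
  shows "cmod ((volt_seq r ^^ k) f n) * s ^ n \<le> A * C ^ k * s ^ (k\<^sup>2) * s ^ (2 * k * n)"
proof (induction k arbitrary: n)
  case 0
  then show ?case
    using assms by (simp add: bounded_by_def)
next
  case (Suc k)
  have "cmod (volt_seq r ((volt_seq r ^^ k) f) n) * s ^ n
      \<le> A * C ^ k * s ^ (k\<^sup>2) * C * s ^ (2 * k + 1) * s ^ (2 * Suc k * n)"
    by (rule volt_seq_bound[OF Suc]) (use s C_pos bounded_by_nonneg[OF assms] in simp)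
  also have "s ^ (k\<^sup>2) * s ^ (2 * k + 1) = s ^ ((Suc k)\<^sup>2)"
  proof -
    have "k\<^sup>2 + (2 * k + 1) = (Suc k)\<^sup>2"
      by (simp add: power2_eq_square)
    then show ?thesis
      by (simp only: flip: power_add)
  qed
  then have "A * C ^ k * s ^ (k\<^sup>2) * C * s ^ (2 * k + 1) = A * C ^ Suc k * s ^ ((Suc k)\<^sup>2)"
    by (simp add: mult_ac)
  finally show ?case
    by simp
qed

lemma volt_seq_power_bound':
  assumes "bounded_by A f"
  shows "cmod ((volt_seq r ^^ k) f n) * s ^ n \<le> A * C ^ k * s ^ (k\<^sup>2)"
proof -
  have "A * C ^ k * s ^ (k\<^sup>2) * s ^ (2 * k * n) \<le> A * C ^ k * s ^ (k\<^sup>2) * 1"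
    using s C_pos bounded_by_nonneg[OF assms] by (intro mult_left_mono power_le_one) auto
  then show ?thesis
    using volt_seq_power_bound[OF assms, of k n] by simp
qed

lemma bounded_by_volt_seq_power:
  "bounded_by A f \<Longrightarrow> bounded_by (A * C ^ k * s ^ (k\<^sup>2)) ((volt_seq r ^^ k) f)"
  using volt_seq_power_bound' by (simp add: bounded_by_def[of "A * _ * _"])

lemma bounded_by_volt_seq: "bounded_by A f \<Longrightarrow> bounded_by (A * C * s) (volt_seq r f)"
  using bounded_by_volt_seq_power[of A f 1] by simp

lemma volt_seq_lincomb:
  assumes "bounded_by A f" "bounded_by B g"
  shows "volt_seq r (\<lambda>n. a * f n + b * g n) = (\<lambda>n. a * volt_seq r f n + b * volt_seq r g n)"
proof
  fix n
  note sm = volt_seq_summable[OF assms(1), of n, THEN summable_norm_cancel]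
    volt_seq_summable[OF assms(2), of n, THEN summable_norm_cancel]
  have "(\<lambda>m. a * (of_nat (m - n) * of_real (r ^ m) * f m) + b * (of_nat (m - n) * of_real (r ^ m) * g m))
      sums (a * volt_seq r f n + b * volt_seq r g n)"
    unfolding volt_seq_def by (intro sums_add sums_mult summable_sums sm)
  then show "volt_seq r (\<lambda>n. a * f n + b * g n) n = a * volt_seq r f n + b * volt_seq r g n"
    unfolding volt_seq_def[of r "\<lambda>n. a * f n + b * g n"] by (simp add: sums_iff algebra_simps)
qed

lemma volt_seq_power_lincomb:
  assumes "bounded_by A f" "bounded_by B g"
  shows "(volt_seq r ^^ k) (\<lambda>n. a * f n + b * g n)
    = (\<lambda>n. a * (volt_seq r ^^ k) f n + b * (volt_seq r ^^ k) g n)"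
proof (induction k)
  case (Suc k)
  have "volt_seq r (\<lambda>n. a * (volt_seq r ^^ k) f n + b * (volt_seq r ^^ k) g n)
      = (\<lambda>n. a * volt_seq r ((volt_seq r ^^ k) f) n + b * volt_seq r ((volt_seq r ^^ k) g) n)"
    using assms[THEN bounded_by_volt_seq_power] by (rule volt_seq_lincomb)
  with Suc show ?case
    by simp
qed simp

section \<open>The Neumann series on sequences\<close>

definition \<Theta> :: "complex \<Rightarrow> real" where
  "\<Theta> z = (\<Sum>k. (cmod z * C) ^ k * s ^ (k\<^sup>2))"

text \<open>Comparison with the base \<open>cmod z * C + 1\<close> covers z = 0, where
  \<open>cmod z * C\<close> is not positive.\<close>

lemma summable_\<Theta>: "summable (\<lambda>k. (cmod z * C) ^ k * s ^ (k\<^sup>2))"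
  by (rule summable_comparison_test'[OF gaussian_series(1)[of "cmod z * C + 1" s]])
    (use s C_pos in \<open>auto intro!: mult_right_mono power_mono simp: add_nonneg_pos\<close>)

lemma resolvent_term_bound:
  assumes "bounded_by A f"
  shows "cmod (z ^ k * (volt_seq r ^^ k) f n) \<le> inverse (s ^ n) * (A * ((cmod z * C) ^ k * s ^ (k\<^sup>2)))"
proof -
  have "cmod (z ^ k * (volt_seq r ^^ k) f n) = inverse (s ^ n) * (cmod z ^ k * (cmod ((volt_seq r ^^ k) f n) * s ^ n))"
    using s by (simp add: norm_mult norm_power)
  also have "\<dots> \<le> inverse (s ^ n) * (cmod z ^ k * (A * C ^ k * s ^ (k\<^sup>2)))"
    using s by (intro mult_left_mono volt_seq_power_bound' assms) auto
  finally show ?thesis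
    by (simp add: power_mult_distrib mult_ac)
qed

lemma resolvent_seq_summable:
  assumes "bounded_by A f"
  shows "summable (\<lambda>k. z ^ k * (volt_seq r ^^ k) f n)"
  by (rule summable_comparison_test'[OF _ resolvent_term_bound[OF assms]])
    (intro summable_mult summable_\<Theta>)

lemma bounded_by_resolvent_seq:
  assumes "bounded_by A f"
  shows "bounded_by (A * \<Theta> z) (resolvent_seq r z f)"
  unfolding bounded_by_def
proof
  fix n
  have "cmod (resolvent_seq r z f n) \<le> (\<Sum>k. inverse (s ^ n) * (A * ((cmod z * C) ^ k * s ^ (k\<^sup>2))))"
    unfolding resolvent_seq_def
    by (rule norm_suminf_le[OF resolvent_term_bound[OF assms]]) (intro summable_mult summable_\<Theta>)
  also have "\<dots> = inverse (s ^ n) * (A * \<Theta> z)"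
    unfolding \<Theta>_def by (simp add: suminf_mult summable_mult summable_\<Theta>)
  finally show "cmod (resolvent_seq r z f n) * s ^ n \<le> A * \<Theta> z"
    using s by (simp add: field_simps)
qed

lemma resolvent_seq_lincomb:
  assumes f: "bounded_by A f" and g: "bounded_by B g"
  shows "resolvent_seq r z (\<lambda>n. a * f n + b * g n) n = a * resolvent_seq r z f n + b * resolvent_seq r z g n"
proof -
  have "(\<lambda>k. a * (z ^ k * (volt_seq r ^^ k) f n) + b * (z ^ k * (volt_seq r ^^ k) g n))
      sums (a * resolvent_seq r z f n + b * resolvent_seq r z g n)"
    unfolding resolvent_seq_def
    by (intro sums_add sums_mult summable_sums resolvent_seq_summable[OF f] resolvent_seq_summable[OF g])
  then show ?thesis
    unfolding resolvent_seq_def[of r z "\<lambda>n. a * f n + b * g n"] volt_seq_power_lincomb[OF f g]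
    by (simp add: sums_iff algebra_simps)
qed

text \<open>Splitting off the term k = 0 and writing B^(k+1) f = B^k (B f) gives R (E - z B) = E for
  the Neumann series R.\<close>

lemma resolvent_seq_volt_seq:
  assumes "bounded_by A f"
  shows "resolvent_seq r z f n = f n + z * resolvent_seq r z (volt_seq r f) n"
proof -
  have "(\<Sum>k. z ^ Suc k * (volt_seq r ^^ Suc k) f n) = resolvent_seq r z f n - f n"
    using suminf_split_head[OF resolvent_seq_summable[OF assms, of z n]]
    by (simp add: resolvent_seq_def)
  moreover have "(\<Sum>k. z * (z ^ k * (volt_seq r ^^ k) (volt_seq r f) n)) = z * resolvent_seq r z (volt_seq r f) n"
    unfolding resolvent_seq_def
    by (rule suminf_mult[OF resolvent_seq_summable[OF bounded_by_volt_seq[OF assms]]])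
  ultimately show ?thesis
    by (simp add: funpow_swap1 mult_ac)
qed

text \<open>The Gaussian bounds on the iterates and the weighted summability of g dominate the
  double series by a product, so the sums may be exchanged. This serves twice: for g m = m - n it
  passes the Volterra operator through the Neumann series, and for the conjugated coefficients of a
  channel function it expands an inner product in powers of z.\<close>

lemma pairing_resolvent_seq:
  assumes f: "bounded_by A f" and g: "summable (\<lambda>m. cmod (g m) * s ^ m)"
  shows "(\<Sum>m. g m * of_real (r ^ m) * resolvent_seq r z f m)
    = (\<Sum>k. z ^ k * (\<Sum>m. g m * of_real (r ^ m) * (volt_seq r ^^ k) f m))" (is "?L = ?R")
    and "cmod (\<Sum>m. g m * of_real (r ^ m) * (volt_seq r ^^ k) f m)
      \<le> ((\<Sum>m. cmod (g m) * s ^ m) * A) * C ^ k * s ^ (k\<^sup>2)" (is "?N \<le> _")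
proof -
  have A: "0 \<le> A"
    using f by (rule bounded_by_nonneg)
  have le: "cmod (g m * of_real (r ^ m) * (volt_seq r ^^ k) f m) \<le> cmod (g m) * s ^ m * (A * C ^ k * s ^ (k\<^sup>2))"
    for m k
  proof -
    have "cmod (g m * of_real (r ^ m) * (volt_seq r ^^ k) f m)
        = cmod (g m) * s ^ m * (cmod ((volt_seq r ^^ k) f m) * s ^ m)"
      using s by (simp add: norm_mult norm_power r_eq power2_eq_square power_mult_distrib mult_ac)
    also have "\<dots> \<le> cmod (g m) * s ^ m * (A * C ^ k * s ^ (k\<^sup>2))"
      using s by (intro mult_left_mono volt_seq_power_bound' f) auto
    finally show ?thesis .
  qed
  have sm: "summable (\<lambda>m. g m * of_real (r ^ m) * (volt_seq r ^^ k) f m)" for k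
    by (rule summable_comparison_test'[OF summable_mult2[OF g] le])
  have "?L = (\<Sum>m. \<Sum>k. z ^ k * (g m * of_real (r ^ m) * (volt_seq r ^^ k) f m))"
    unfolding resolvent_seq_def
    by (subst suminf_mult[symmetric]) (auto simp: mult_ac intro: resolvent_seq_summable[OF f])
  also have "\<dots> = (\<Sum>k. \<Sum>m. z ^ k * (g m * of_real (r ^ m) * (volt_seq r ^^ k) f m))"
  proof (rule suminf_swap_product_bound[OF _ g])
    show "cmod (z ^ k * (g m * of_real (r ^ m) * (volt_seq r ^^ k) f m))
        \<le> cmod (g m) * s ^ m * (A * ((cmod z * C) ^ k * s ^ (k\<^sup>2)))" for m k
      using mult_left_mono[OF le[of m k], of "cmod z ^ k"]
      by (simp add: norm_mult norm_power power_mult_distrib mult_ac)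
  qed (use s A C_pos in \<open>auto intro!: summable_mult summable_\<Theta>\<close>)
  also have "\<dots> = ?R"
    by (simp only: suminf_mult[OF sm])
  finally show "?L = ?R" .
  have "?N \<le> (\<Sum>m. cmod (g m) * s ^ m * (A * C ^ k * s ^ (k\<^sup>2)))"
    by (rule norm_suminf_le[OF le]) (intro summable_mult2 g)
  also have "\<dots> = (\<Sum>m. cmod (g m) * s ^ m) * (A * C ^ k * s ^ (k\<^sup>2))"
    by (rule suminf_mult2[OF g, symmetric])
  also have "\<dots> = ((\<Sum>m. cmod (g m) * s ^ m) * A) * C ^ k * s ^ (k\<^sup>2)"
    by (simp only: mult.assoc)
  finally show "?N \<le> ((\<Sum>m. cmod (g m) * s ^ m) * A) * C ^ k * s ^ (k\<^sup>2)" .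
qed

text \<open>The value of B at n is the pairing with the kernel m - n, so B commutes with the Neumann
  series R. Hence R (E - z B) = E also yields (E - z B) R = E.\<close>

lemma volt_seq_resolvent_seq:
  assumes "bounded_by A f"
  shows "resolvent_seq r z f n = f n + z * volt_seq r (resolvent_seq r z f) n"
proof -
  have g: "summable (\<lambda>m. cmod (of_nat (m - n)) * s ^ m)"
    using sums_shifted_of_nat_power[of s n] s by (simp add: sums_iff)
  have "volt_seq r (resolvent_seq r z f) n = resolvent_seq r z (volt_seq r f) n"
    unfolding volt_seq_def[of r "resolvent_seq r z f"] pairing_resolvent_seq(1)[OF assms g]
      resolvent_seq_def[of r z "volt_seq r f"]
    by (simp only: volt_seq_def[symmetric] funpow_swap1[symmetric])
  then show ?thesis
    using resolvent_seq_volt_seq[OF assms] by simp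
qed

lemma resolvent_seq_left_inverse:
  assumes "bounded_by A f"
  shows "resolvent_seq r z (\<lambda>n. f n - z * volt_seq r f n) n = f n"
  using resolvent_seq_lincomb[OF assms bounded_by_volt_seq[OF assms], of z 1 "- z" n]
    resolvent_seq_volt_seq[OF assms, of z n] by simp

text \<open>The difference is z B R f, and B turns growth s^(-n) into decay s^n, so the difference
  is bounded. The growth bound on R f alone would not give square summability, because r^n s^(-2n) =
  1.\<close>

lemma resolvent_seq_minus_bound:
  assumes "bounded_by A f"
  shows "cmod (resolvent_seq r z f n - f n) \<le> cmod z * (A * \<Theta> z * C * s)"
proof -
  define g where "g = resolvent_seq r z f"
  have g: "bounded_by (A * \<Theta> z) g"
    unfolding g_def by (rule bounded_by_resolvent_seq[OF assms])
  have "cmod (volt_seq r g n) * s ^ n \<le> A * \<Theta> z * C * s * s ^ (2 * n)"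
    using volt_seq_bound[of g "A * \<Theta> z" 0 n] g bounded_by_nonneg[OF g] by (simp add: bounded_by_def)
  then have "cmod (volt_seq r g n) \<le> A * \<Theta> z * C * s * s ^ n"
    using s by (simp add: power_mult power2_eq_square power_mult_distrib mult.assoc[symmetric])
  also have "\<dots> \<le> A * \<Theta> z * C * s * 1"
    using bounded_by_nonneg[OF g] s C_pos by (intro mult_left_mono power_le_one) auto
  finally have "cmod z * cmod (volt_seq r g n) \<le> cmod z * (A * \<Theta> z * C * s)"
    by (intro mult_left_mono) auto
  then show ?thesis
    using volt_seq_resolvent_seq[OF assms, of z n] by (simp add: g_def norm_mult)
qed

text \<open>The norm of \<open>L\<^sup>2(O)\<close> on radial functions: the shell \<open>\<bar>x\<bar> = r\<^sup>n\<close> has mass \<open>(1 - r) r\<^sup>n\<close>.\<close>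

definition norm2 :: "(nat \<Rightarrow> complex) \<Rightarrow> real" where
  "norm2 f = (\<Sum>n. (1 - r) * r ^ n * (cmod (f n))\<^sup>2)"

definition l2_seq :: "(nat \<Rightarrow> complex) \<Rightarrow> bool" where
  "l2_seq f \<longleftrightarrow> summable (\<lambda>n. (1 - r) * r ^ n * (cmod (f n))\<^sup>2)"

lemma norm2_nonneg: "l2_seq f \<Longrightarrow> 0 \<le> norm2 f"
  unfolding norm2_def l2_seq_def using r by (intro suminf_nonneg) auto

text \<open>A single term of the norm series is at most its sum, and r^n is the square of
  s^n.\<close>

lemma l2_seq_bounded_by:
  assumes "l2_seq f"
  shows "bounded_by (sqrt (norm2 f / (1 - r))) f"
  unfolding bounded_by_def
proof
  fix n
  have "(\<Sum>k\<in>{n}. (1 - r) * r ^ k * (cmod (f k))\<^sup>2) \<le> norm2 f"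
    unfolding norm2_def by (rule sum_le_suminf) (use assms r in \<open>auto simp: l2_seq_def\<close>)
  then have "(cmod (f n) * s ^ n)\<^sup>2 \<le> norm2 f / (1 - r)"
    using r by (simp add: r_eq field_simps power_mult_distrib flip: power_mult)
  then show "cmod (f n) * s ^ n \<le> sqrt (norm2 f / (1 - r))"
    by (rule real_le_rsqrt)
qed

definition resolvent_bound :: "complex \<Rightarrow> real" where
  "resolvent_bound z = 2 + 2 * (cmod z * \<Theta> z * C * s)\<^sup>2 / (1 - r)"

text \<open>R f is f plus a bounded sequence, and |a + b|^2 \<le> 2|a|^2 + 2|b|^2. The weights (1 -
  r) r^n have sum 1, so the bounded part contributes at most 2 D; this is where
  \<open>resolvent_bound\<close> comes from.\<close>

lemma resolvent_seq_l2:
  assumes "l2_seq f"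
  shows "l2_seq (resolvent_seq r z f)" and "norm2 (resolvent_seq r z f) \<le> resolvent_bound z * norm2 f"
proof -
  define D where "D = (cmod z * \<Theta> z * C * s)\<^sup>2 * (norm2 f / (1 - r))"
  have D: "(cmod (resolvent_seq r z f n - f n))\<^sup>2 \<le> D" for n
  proof -
    have "(cmod (resolvent_seq r z f n - f n))\<^sup>2
        \<le> (cmod z * (sqrt (norm2 f / (1 - r)) * \<Theta> z * C * s))\<^sup>2"
      by (intro power_mono resolvent_seq_minus_bound l2_seq_bounded_by assms) auto
    also have "\<dots> = D"
      using r norm2_nonneg[OF assms] by (simp add: D_def power_mult_distrib)
    finally show ?thesis .
  qed
  have le: "(1 - r) * r ^ n * (cmod (resolvent_seq r z f n))\<^sup>2
      \<le> 2 * ((1 - r) * r ^ n * (cmod (f n))\<^sup>2) + 2 * D * (1 - r) * r ^ n" for n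
  proof -
    have "cmod (resolvent_seq r z f n) \<le> cmod (f n) + cmod (resolvent_seq r z f n - f n)"
      using norm_triangle_sub by blast
    then have "(cmod (resolvent_seq r z f n))\<^sup>2 \<le> (cmod (f n) + cmod (resolvent_seq r z f n - f n))\<^sup>2"
      by (intro power_mono) auto
    also have "\<dots> \<le> 2 * (cmod (f n))\<^sup>2 + 2 * (cmod (resolvent_seq r z f n - f n))\<^sup>2"
      using sum_squares_bound[of "cmod (f n)" "cmod (resolvent_seq r z f n - f n)"]
      by (simp add: power2_sum)
    also have "\<dots> \<le> 2 * (cmod (f n))\<^sup>2 + 2 * D"
      using D[of n] by simp
    finally have "(1 - r) * r ^ n * (cmod (resolvent_seq r z f n))\<^sup>2
        \<le> (1 - r) * r ^ n * (2 * (cmod (f n))\<^sup>2 + 2 * D)"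
      using r by (intro mult_left_mono) auto
    then show ?thesis
      by (simp add: algebra_simps)
  qed
  have sums: "(\<lambda>n. 2 * ((1 - r) * r ^ n * (cmod (f n))\<^sup>2) + 2 * D * (1 - r) * r ^ n)
      sums (2 * norm2 f + 2 * D * (1 - r) * (1 / (1 - r)))"
    unfolding norm2_def using assms r
    by (intro sums_add sums_mult summable_sums geometric_sums) (auto simp: l2_seq_def)
  show l2: "l2_seq (resolvent_seq r z f)"
    unfolding l2_seq_def
    by (rule summable_comparison_test'[OF sums_summable[OF sums]]) (use le r in auto)
  have "norm2 (resolvent_seq r z f) \<le> 2 * norm2 f + 2 * D * (1 - r) * (1 / (1 - r))"
    unfolding norm2_def[of "resolvent_seq r z f"] sums_unique[OF sums]
    by (rule suminf_le[OF le]) (use l2 sums in \<open>auto simp: l2_seq_def sums_iff\<close>)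
  also have "\<dots> = resolvent_bound z * norm2 f"
    using r by (simp add: resolvent_bound_def D_def distrib_right)
  finally show "norm2 (resolvent_seq r z f) \<le> resolvent_bound z * norm2 f" .
qed

end

section \<open>Haar measure of the spheres\<close>

locale haar_nonarch_field =
  nonarch_local_field absK + normalized_haar_measure absK \<mu>
  for absK :: "'a::{field, t2_space, topological_ab_group_add, topological_semigroup_mult} \<Rightarrow> real"
    and \<mu> :: "'a measure"
begin

definition q :: real where "q = real (residue_card absK)"
definition r :: real where "r = 1 / q"

lemma abs_0 [simp]: "absK 0 = 0"
  by (simp add: abs_eq_0_iff)

lemma abs_pos: "x \<noteq> 0 \<Longrightarrow> 0 < absK x"
  using abs_nonneg[of x] abs_eq_0_iff[of x] by linarith

lemma abs_1 [simp]: "absK 1 = 1"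
  using abs_mult[of 1 1] abs_pos[of 1] by simp

lemma abs_minus [simp]: "absK (- x) = absK x"
proof -
  have "absK (- 1) * absK (- 1) = 1"
    using abs_mult[of "- 1" "- 1"] by simp
  then have "absK (- 1) = 1"
    using abs_nonneg[of "- 1"] by (simp add: square_eq_1_iff)
  then show ?thesis
    using abs_mult[of "- 1" x] by simp
qed

lemma abs_minus_commute: "absK (x - y) = absK (y - x)"
  using abs_minus[of "x - y"] by simp

lemma abs_power: "absK (x ^ n) = absK x ^ n"
  by (induction n) (auto simp: abs_mult)

lemma abs_triangle: "absK x \<le> c \<Longrightarrow> absK y \<le> c \<Longrightarrow> absK (x + y) \<le> c"
  using abs_ultrametric[of x y] by linarith

text \<open>P and 1 + P are two different residue classes.\<close>

lemma q_gt_1: "q > 1"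
proof -
  have "maximal_ideal absK \<in> residue_classes absK"
    unfolding residue_classes_def by (rule image_eqI[of _ _ 0]) (auto simp: ring_of_integers_def)
  moreover have "(+) 1 ` maximal_ideal absK \<in> residue_classes absK"
    unfolding residue_classes_def by (auto simp: ring_of_integers_def)
  ultimately have "{maximal_ideal absK, (+) 1 ` maximal_ideal absK} \<subseteq> residue_classes absK"
    by simp
  moreover have "1 \<in> (+) 1 ` maximal_ideal absK" "1 \<notin> maximal_ideal absK"
    by (auto simp: maximal_ideal_def image_iff intro!: bexI[of _ 0])
  then have "card {maximal_ideal absK, (+) 1 ` maximal_ideal absK} = 2"
    by (auto simp: card_2_iff)
  ultimately have "2 \<le> residue_card absK"
    unfolding residue_card_def by (metis card_mono finite_residue_classes)
  then show ?thesis
    by (simp add: q_def)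
qed

lemma r: "0 < r" "r < 1"
  using q_gt_1 by (auto simp: r_def)

lemma abs_integer_value:
  assumes "x \<noteq> 0" "absK x \<le> 1"
  obtains n where "absK x = r ^ n"
proof -
  have "absK x \<in> absK ` (- {0})"
    using assms by simp
  then obtain N :: int where N: "absK x = q powi N"
    unfolding abs_normalized q_def by auto
  have "N \<le> 0"
  proof (rule ccontr)
    assume "\<not> N \<le> 0"
    then have "1 < q ^ nat N"
      using q_gt_1 by (intro one_less_power) auto
    then show False
      using assms N \<open>\<not> N \<le> 0\<close> by (simp add: power_int_def)
  qed
  then have "absK x = r ^ nat (- N)"
    using N by (auto simp: power_int_def r_def power_divide field_simps)
  then show ?thesis ..
qed

lemma uniformizer: obtains p where "absK p = r"
proof -
  have "q powi (- 1) \<in> absK ` (- {0})"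
    unfolding abs_normalized q_def by (rule rangeI)
  then obtain p where "q powi (- 1) = absK p"
    by (rule imageE)
  then have "absK p = r"
    by (simp add: r_def power_int_def inverse_eq_divide)
  then show ?thesis ..
qed

text \<open>Up to translation these balls are the powers of P: \<open>disc 0 0\<close> is O,
  \<open>disc 0 1\<close> is P, and the residue classes are the balls of radius r centred in
  O.\<close>

definition disc :: "'a \<Rightarrow> nat \<Rightarrow> 'a set" where
  "disc a n = {x. absK (x - a) \<le> r ^ n}"

lemma disc_translate: "(+) a ` disc b n = disc (a + b) n"
proof -
  have "x \<in> (+) a ` disc b n" if "x \<in> disc (a + b) n" for x
    using that by (intro image_eqI[of _ _ "x - a"]) (auto simp: disc_def algebra_simps)
  then show ?thesis
    by (auto simp: disc_def)
qed

lemma disc_scale: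
  assumes "absK p = r"
  shows "(*) (p ^ k) ` disc a n = disc (p ^ k * a) (k + n)"
proof -
  have p: "p \<noteq> 0"
    using assms r by auto
  have "x \<in> (*) (p ^ k) ` disc a n" if "x \<in> disc (p ^ k * a) (k + n)" for x
  proof (rule image_eqI)
    show "x = p ^ k * (x / p ^ k)"
      using p by simp
    have "absK (x - p ^ k * a) = r ^ k * absK (x / p ^ k - a)"
      using p assms abs_mult[of "p ^ k" "x / p ^ k - a"] by (simp add: abs_power right_diff_distrib)
    then show "x / p ^ k \<in> disc a n"
      using that r by (simp add: disc_def power_add)
  qed
  moreover have "p ^ k * x \<in> disc (p ^ k * a) (k + n)" if "x \<in> disc a n" for x
    using that r abs_mult[of "p ^ k" "x - a"] assms
    by (simp add: disc_def abs_power power_add right_diff_distrib)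
  ultimately show ?thesis
    by auto
qed

text \<open>By the ultrametric inequality a closed ball contains the open ball of the same radius
  about each of its points.\<close>

lemma open_disc: "open (disc a n)"
  unfolding open_iff_abs
proof (intro ballI exI conjI allI impI)
  show "0 < r ^ n"
    using r by simp
  fix x y assume "x \<in> disc a n" "absK (y - x) < r ^ n"
  then show "y \<in> disc a n"
    using abs_triangle[of "y - x" "r ^ n" "x - a"] by (simp add: disc_def)
qed

lemma disc_sets [measurable]: "disc a n \<in> sets \<mu>"
  by (simp add: sets_haar open_disc)

lemma ring_of_integers_eq: "ring_of_integers absK = disc 0 0"
  by (simp add: ring_of_integers_def disc_def)

text \<open>The value group is discrete: no absolute value lies strictly between r and 1.\<close>

lemma maximal_ideal_eq: "maximal_ideal absK = disc 0 1"
proof -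
  have "absK x \<le> r" if "absK x < 1" for x
  proof (cases "x = 0")
    case False
    then obtain n where n: "absK x = r ^ n"
      using abs_integer_value \<open>absK x < 1\<close> by (meson less_imp_le)
    with that have "n \<noteq> 0"
      by (intro notI) simp
    then show ?thesis
      using power_decreasing[of 1 n r] r n by simp
  qed (use r in simp)
  then show ?thesis
    using r by (force simp: maximal_ideal_def disc_def)
qed

lemma emeasure_disc_translate: "emeasure \<mu> (disc a n) = emeasure \<mu> (disc 0 n)"
  using translation_invariant[of "disc 0 n" a] open_disc by (simp add: disc_translate)

lemma disc_eqI: "absK (a - b) \<le> r ^ n \<Longrightarrow> disc a n = disc b n"
proof (intro set_eqI iffI)
  fix x assume ab: "absK (a - b) \<le> r ^ n"
  show "x \<in> disc b n" if "x \<in> disc a n"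
    using that abs_triangle[of "x - a" "r ^ n" "a - b"] ab by (simp add: disc_def)
  show "x \<in> disc a n" if "x \<in> disc b n"
    using that abs_triangle[of "x - b" "r ^ n" "b - a"] ab by (simp add: disc_def abs_minus_commute)
qed

text \<open>Multiplication by the \<open>n\<close>-th power of a uniformizer carries the \<open>q\<close> cosets of \<open>P\<close> in \<open>O\<close>
  to \<open>q\<close> translates of the disc of radius \<open>r\<^sup>n\<^sup>+\<^sup>1\<close> that partition the disc of radius \<open>r\<^sup>n\<close>.\<close>

lemma emeasure_disc_Suc: "emeasure \<mu> (disc 0 n) = ennreal q * emeasure \<mu> (disc 0 (Suc n))"
proof -
  obtain p where p: "absK p = r"
    by (rule uniformizer)
  have p0: "p \<noteq> 0"
    using p r by auto
  let ?R = "residue_classes absK"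
  have R: "\<exists>a\<in>disc 0 0. c = disc a 1" if "c \<in> ?R" for c
    using that by (auto simp: residue_classes_def ring_of_integers_eq maximal_ideal_eq disc_translate)
  define F where "F = (\<lambda>c. (*) (p ^ n) ` c)"
  have F: "\<exists>a. F c = disc a (Suc n)" if "c \<in> ?R" for c
    using R[OF that] disc_scale[OF p] by (auto simp: F_def)
  have "\<Union> ?R = disc 0 0"
  proof -
    have "disc a 1 \<subseteq> disc 0 0" if "a \<in> disc 0 0" for a
    proof
      fix x assume "x \<in> disc a 1"
      then show "x \<in> disc 0 0"
        using that r abs_triangle[of "x - a" 1 a] by (simp add: disc_def)
    qed
    moreover have "x \<in> \<Union> ?R" if "x \<in> disc 0 0" for x
      using that r by (auto simp: residue_classes_def ring_of_integers_eq maximal_ideal_eq disc_translate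
        disc_def intro!: bexI[of _ x])
    ultimately show ?thesis
      using R by blast
  qed
  then have "(\<Union>c\<in>?R. F c) = disc 0 n"
    using disc_scale[OF p, of n 0 0] by (simp add: F_def flip: image_Union)
  moreover have "disjoint_family_on F ?R"
    unfolding disjoint_family_on_def
  proof (intro ballI impI)
    fix c d assume c: "c \<in> ?R" and d: "d \<in> ?R" and "c \<noteq> d"
    obtain a b where ab: "c = disc a 1" "d = disc b 1"
      using R[OF c] R[OF d] by auto
    have "c \<inter> d = {}"
    proof (rule ccontr)
      assume "c \<inter> d \<noteq> {}"
      then obtain x where "absK (x - a) \<le> r ^ 1" "absK (x - b) \<le> r ^ 1"
        by (auto simp: ab disc_def)
      then have "absK (a - b) \<le> r ^ 1"
        using abs_triangle[of "a - x" "r ^ 1" "x - b"] abs_minus_commute[of a x] by simp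
      then show False
        using \<open>c \<noteq> d\<close> disc_eqI ab by blast
    qed
    then show "F c \<inter> F d = {}"
      unfolding F_def using p0 by (auto simp: image_iff)
  qed
  moreover have "F ` ?R \<subseteq> sets \<mu>"
    using F disc_sets by fastforce
  ultimately have "emeasure \<mu> (disc 0 n) = (\<Sum>c\<in>?R. emeasure \<mu> (F c))"
    using sum_emeasure[OF _ _ finite_residue_classes] by metis
  also have "\<dots> = (\<Sum>c\<in>?R. emeasure \<mu> (disc 0 (Suc n)))"
    by (rule sum.cong) (use F emeasure_disc_translate in metis)+
  finally show ?thesis
    by (simp add: q_def residue_card_def ennreal_of_nat_eq_real_of_nat)
qed

lemma emeasure_disc: "emeasure \<mu> (disc 0 n) = ennreal (r ^ n)"
proof (induction n)
  case 0
  then show ?case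
    using haar_integers by (simp add: ring_of_integers_eq)
next
  case (Suc n)
  have "ennreal r * ennreal q = 1"
    using q_gt_1 by (simp add: r_def flip: ennreal_mult)
  then have "emeasure \<mu> (disc 0 (Suc n)) = ennreal r * emeasure \<mu> (disc 0 n)"
    by (simp add: emeasure_disc_Suc[of n] flip: mult.assoc)
  then show ?case
    using r by (simp add: Suc ennreal_mult')
qed

text \<open>A point of the difference is nonzero and lies in O, so its absolute value is some r^k,
  and the two inequalities leave only k = n.\<close>

lemma disc_diff_Suc: "disc 0 n - disc 0 (Suc n) = {x. absK x = r ^ n}"
proof (intro set_eqI iffI)
  fix x assume x: "x \<in> disc 0 n - disc 0 (Suc n)"
  then have "x \<noteq> 0" "absK x \<le> 1"
    using r power_le_one[of r n] by (auto simp: disc_def)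
  then obtain k where k: "absK x = r ^ k"
    by (rule abs_integer_value)
  have "r ^ k \<le> r ^ n" "\<not> r ^ k \<le> r ^ Suc n"
    using x by (simp_all only: disc_def k[symmetric] Diff_iff mem_Collect_eq diff_zero not_False_eq_True)
  then have "n \<le> k" "\<not> Suc n \<le> k"
    using r by (simp_all add: power_decreasing_iff del: power_Suc)
  then have "k = n"
    by simp
  with k show "x \<in> {x. absK x = r ^ n}"
    by simp
qed (use r in \<open>auto simp: disc_def\<close>)

lemma disc_mono: "m \<le> n \<Longrightarrow> disc a n \<subseteq> disc a m"
  using power_decreasing[of m n r] r by (auto simp: disc_def intro: order_trans)

lemma emeasure_shell: "emeasure \<mu> {x. absK x = r ^ n} = ennreal ((1 - r) * r ^ n)"
proof -
  have "emeasure \<mu> {x. absK x = r ^ n} = emeasure \<mu> (disc 0 n) - emeasure \<mu> (disc 0 (Suc n))"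
    unfolding disc_diff_Suc[symmetric]
    by (rule emeasure_Diff) (auto simp: emeasure_disc disc_mono simp del: power_Suc)
  then show ?thesis
    using r by (simp add: emeasure_disc ennreal_minus algebra_simps del: power_Suc) (simp add: algebra_simps)
qed

text \<open>The point 0 lies in balls of measure r^n for every n. It is on none of the spheres, so
  it has to be discarded as a null set.\<close>

lemma emeasure_0: "emeasure \<mu> {0} = 0"
proof -
  have "emeasure \<mu> {0} \<le> ennreal (r ^ n)" for n
  proof -
    have "{0} \<subseteq> disc 0 n"
      using r by (simp add: disc_def)
    then show ?thesis
      using emeasure_mono[of "{0}" "disc 0 n" \<mu>] by (simp add: emeasure_disc)
  qed
  moreover have "(\<lambda>n. ennreal (r ^ n)) \<longlonglongrightarrow> ennreal 0"
    using r by (intro tendsto_ennrealI LIMSEQ_realpow_zero) auto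
  ultimately have "emeasure \<mu> {0} \<le> 0"
    using LIMSEQ_le_const[of "\<lambda>n. ennreal (r ^ n)" 0 "emeasure \<mu> {0}"] by auto
  then show ?thesis
    by simp
qed

section \<open>Integrals over O as weighted sums over spheres\<close>

abbreviation M :: "'a measure" where "M \<equiv> integers_measure absK \<mu>"

text \<open>The value \<open>index 0 = 0\<close> matches \<open>ln 0 = 0\<close>, so that \<open>ln (absK x) = - index x * ln q\<close> holds
  on all of \<open>O\<close>.\<close>

definition index :: "'a \<Rightarrow> nat" where
  "index x = (if x = 0 then 0 else THE n. absK x = r ^ n)"

lemma index_0 [simp]: "index 0 = 0"
  by (simp add: index_def)

lemma index_eqI:
  assumes "absK x = r ^ n"
  shows "index x = n"
proof -
  have "x \<noteq> 0"
    using assms r by auto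
  moreover have "(THE k. absK x = r ^ k) = n"
    by (rule the_equality) (use assms r in \<open>auto simp: power_inject_exp'\<close>)
  ultimately show ?thesis
    by (simp add: index_def)
qed

lemma abs_eq_power_index:
  assumes "x \<noteq> 0" "absK x \<le> 1"
  shows "absK x = r ^ index x"
proof -
  obtain n where n: "absK x = r ^ n"
    using abs_integer_value assms by blast
  then show ?thesis
    by (simp add: index_eqI[OF n])
qed

lemma space_M: "space M = disc 0 0"
proof -
  have "space \<mu> = UNIV"
    using sets_eq_imp_space_eq[OF sets_haar] by simp
  then show ?thesis
    by (simp add: integers_measure_def space_restrict_space ring_of_integers_eq)
qed

lemma in_space_M: "x \<in> space M \<longleftrightarrow> absK x \<le> 1"
  by (simp add: space_M disc_def)

lemma sets_M: "A \<in> sets M \<longleftrightarrow> A \<subseteq> disc 0 0 \<and> A \<in> sets \<mu>"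
proof -
  have "disc 0 0 \<inter> space \<mu> \<in> sets \<mu>"
    by simp
  then show ?thesis
    unfolding integers_measure_def ring_of_integers_eq by (rule sets_restrict_space_iff)
qed

lemma emeasure_M: "A \<subseteq> disc 0 0 \<Longrightarrow> emeasure M A = emeasure \<mu> A"
  unfolding integers_measure_def ring_of_integers_eq
  by (rule emeasure_restrict_space) simp_all

lemma AE_M_nonzero: "AE x in M. x \<noteq> 0"
proof (rule AE_I')
  have "{0} \<in> sets \<mu>"
    by (simp add: sets_haar)
  moreover have "{0} \<subseteq> disc 0 0"
    by (simp add: disc_def)
  ultimately show "{0} \<in> null_sets M"
    using emeasure_0 by (auto simp: null_sets_def sets_M emeasure_M)
qed auto

lemma shell_subset: "{x. absK x = r ^ n} \<subseteq> disc 0 0"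
  using r by (auto simp: disc_def power_le_one)

lemma shell_sets: "{x. absK x = r ^ n} \<in> sets \<mu>"
  unfolding disc_diff_Suc[symmetric] by simp

text \<open>The default \<open>index 0 = 0\<close> puts the point 0 into the fibre over 0, next to
  the unit sphere.\<close>

lemma index_vimage: "index -` {n} \<inter> space M = {x. absK x = r ^ n} \<union> (if n = 0 then {0} else {})"
proof (intro set_eqI iffI)
  fix x assume x: "x \<in> index -` {n} \<inter> space M"
  show "x \<in> {x. absK x = r ^ n} \<union> (if n = 0 then {0} else {})"
  proof (cases "x = 0")
    case False
    moreover have "absK x \<le> 1" "index x = n"
      using x by (simp_all add: in_space_M)
    ultimately show ?thesis
      using abs_eq_power_index[of x] by simp
  next
    case True
    then show ?thesis
      using x by simp
  qed
next
  fix x assume "x \<in> {x. absK x = r ^ n} \<union> (if n = 0 then {0} else {})"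
  then consider "absK x = r ^ n" | "n = 0" "x = 0"
    by (auto split: if_splits)
  then show "x \<in> index -` {n} \<inter> space M"
  proof cases
    case 1
    then show ?thesis
      using index_eqI[OF 1] shell_subset[of n] by (auto simp: space_M)
  qed (simp add: in_space_M)
qed

lemma shell_sets_M: "{x. absK x = r ^ n} \<in> sets M"
  using shell_sets shell_subset by (simp add: sets_M)

lemma index_vimage_sets: "index -` {n} \<inter> space M \<in> sets M"
proof -
  have "{0} \<in> sets M"
    by (simp add: sets_M sets_haar disc_def)
  then show ?thesis
    unfolding index_vimage using shell_sets_M[of n] by (auto intro: sets.Un simp del: Un_insert_right)
qed

lemma index_measurable [measurable]: "index \<in> measurable M (count_space UNIV)"
  unfolding measurable_count_space_eq2_countable
  by (auto intro: index_vimage_sets)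

text \<open>Up to the null set {0} the fibre over n is the sphere of radius r^n, and a measure on a
  countable space is determined by its singletons. Change of variables then turns integrals over O
  into series.\<close>

lemma distr_index: "distr M (count_space UNIV) index = density (count_space UNIV) (\<lambda>n. ennreal ((1 - r) * r ^ n))"
proof (rule measure_eqI_countable[of _ UNIV])
  fix n
  have "emeasure (distr M (count_space UNIV) index) {n} = emeasure M (index -` {n} \<inter> space M)"
    by (simp add: emeasure_distr)
  also have "\<dots> = emeasure M {x. absK x = r ^ n}"
  proof (rule emeasure_eq_AE)
    show "AE x in M. x \<in> index -` {n} \<inter> space M \<longleftrightarrow> x \<in> {x. absK x = r ^ n}"
      using AE_M_nonzero by eventually_elim (auto simp: index_vimage split: if_splits)
  qed (intro index_vimage_sets shell_sets_M)+
  also have "\<dots> = ennreal ((1 - r) * r ^ n)"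
    by (simp add: emeasure_M shell_subset emeasure_shell)
  finally show "emeasure (distr M (count_space UNIV) index) {n}
      = emeasure (density (count_space UNIV) (\<lambda>n. ennreal ((1 - r) * r ^ n))) {n}"
    by (simp add: emeasure_density)
qed auto

text \<open>Every sphere has positive mass (1 - r) r^n, so a property of the index cannot fail on
  one of them and still hold almost everywhere.\<close>

lemma AE_index_iff: "(AE x in M. P (index x)) \<longleftrightarrow> (\<forall>n. P n)"
proof -
  have "(AE x in M. P (index x)) \<longleftrightarrow> (AE n in distr M (count_space UNIV) index. P n)"
    by (subst AE_distr_iff) auto
  also have "\<dots> \<longleftrightarrow> (\<forall>n. P n)"
    unfolding distr_index using r by (subst AE_density) (auto simp: AE_count_space)
  finally show ?thesis .
qed

lemma integrable_index_iff:
  fixes g :: "nat \<Rightarrow> 'b::{banach, second_countable_topology}"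
  shows "integrable M (\<lambda>x. g (index x)) \<longleftrightarrow> summable (\<lambda>n. norm (((1 - r) * r ^ n) *\<^sub>R g n))"
proof -
  have "integrable M (\<lambda>x. g (index x)) \<longleftrightarrow> integrable (distr M (count_space UNIV) index) g"
    by (rule integrable_distr_eq[symmetric]) auto
  also have "\<dots> \<longleftrightarrow> integrable (count_space UNIV) (\<lambda>n. ((1 - r) * r ^ n) *\<^sub>R g n)"
    unfolding distr_index using r by (intro integrable_density) auto
  finally show ?thesis
    unfolding integrable_count_space_nat_iff .
qed

lemma integral_index:
  fixes g :: "nat \<Rightarrow> 'b::{banach, second_countable_topology}"
  assumes "summable (\<lambda>n. norm (((1 - r) * r ^ n) *\<^sub>R g n))"
  shows "(LINT x|M. g (index x)) = (\<Sum>n. ((1 - r) * r ^ n) *\<^sub>R g n)"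
proof -
  have "(LINT x|M. g (index x)) = integral\<^sup>L (distr M (count_space UNIV) index) g"
    by (rule integral_distr[symmetric]) auto
  also have "\<dots> = (LINT n|count_space UNIV. ((1 - r) * r ^ n) *\<^sub>R g n)"
    unfolding distr_index using r by (intro integral_density) auto
  also have "\<dots> = (\<Sum>n. ((1 - r) * r ^ n) *\<^sub>R g n)"
    using assms by (intro integral_count_space_nat) (simp only: integrable_count_space_nat_iff)
  finally show ?thesis .
qed

section \<open>The operator on radial functions\<close>

sublocale seq: volterra_sequences "sqrt r" r
  by unfold_locales (use r in auto)

abbreviation H :: "('a \<Rightarrow> complex) set" where "H \<equiv> radial_L2 absK \<mu>"

text \<open>For u in H the choice is unique, because no sphere is a null set; \<open>coef\<close>
  therefore depends only on the class of u in L2.\<close>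

definition coef :: "('a \<Rightarrow> complex) \<Rightarrow> nat \<Rightarrow> complex" where
  "coef u = (SOME f. AE x in M. u x = f (index x))"

lemma coef_eqI:
  assumes "AE x in M. u x = f (index x)"
  shows "coef u = f"
proof -
  have "AE x in M. u x = coef u (index x)"
    unfolding coef_def by (rule someI[of _ f]) (rule assms)
  with assms have "AE x in M. coef u (index x) = f (index x)"
    by eventually_elim simp
  then show ?thesis
    unfolding AE_index_iff[of "\<lambda>n. coef u n = f n"] by blast
qed

lemma AE_M_abs: "AE x in M. x \<noteq> 0 \<and> absK x = r ^ index x"
  using AE_M_nonzero AE_space
  by eventually_elim (simp add: in_space_M abs_eq_power_index[symmetric])

lemma comp_index_measurable [measurable]:
  fixes f :: "nat \<Rightarrow> complex"
  shows "(\<lambda>x. f (index x)) \<in> borel_measurable M"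
  by measurable

lemma integrable_iff_l2_seq:
  assumes "u \<in> borel_measurable M" "AE x in M. u x = f (index x)"
  shows "integrable M (\<lambda>x. (cmod (u x))\<^sup>2) \<longleftrightarrow> seq.l2_seq f"
proof -
  have "integrable M (\<lambda>x. (cmod (u x))\<^sup>2) \<longleftrightarrow> integrable M (\<lambda>x. (cmod (f (index x)))\<^sup>2)"
    by (rule integrable_cong_AE) (use assms in auto)
  also have "\<dots> \<longleftrightarrow> seq.l2_seq f"
    unfolding integrable_index_iff[of "\<lambda>n. (cmod (f n))\<^sup>2"] seq.l2_seq_def using r by (simp add: abs_mult)
  finally show ?thesis .
qed

lemma radial_L2_I:
  assumes "u \<in> borel_measurable M" and u: "AE x in M. u x = f (index x)" and "seq.l2_seq f"
  shows "u \<in> H"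
proof -
  \<comment> \<open>The definite description inverts n \<mapsto> r^n and so turns a function of the
    index into a function of the absolute value.\<close>
  have "AE x in M. u x = (f \<circ> (\<lambda>t. THE n. t = r ^ n)) (absK x)"
    using u AE_M_abs
  proof eventually_elim
    case (elim x)
    have "(THE n. r ^ index x = r ^ n) = index x"
      by (rule the_equality) (use r in \<open>auto simp: power_inject_exp'\<close>)
    with elim show ?case
      by simp
  qed
  then show ?thesis
    using assms unfolding radial_L2_def L2_def l2_eq_def
    by (auto simp: integrable_iff_l2_seq)
qed

lemma radial_L2_D:
  assumes "u \<in> H"
  shows "u \<in> borel_measurable M" "AE x in M. u x = coef u (index x)" "seq.l2_seq (coef u)"
proof -
  show u: "u \<in> borel_measurable M"
    using assms by (simp add: radial_L2_def L2_def)
  obtain f where "AE x in M. u x = f (absK x)"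
    using assms by (auto simp: radial_L2_def l2_eq_def)
  then have "AE x in M. u x = (\<lambda>n. f (r ^ n)) (index x)"
    using AE_M_abs by eventually_elim simp
  then show *: "AE x in M. u x = coef u (index x)"
    using coef_eqI[of u "\<lambda>n. f (r ^ n)"] by simp
  show "seq.l2_seq (coef u)"
    using integrable_iff_l2_seq[OF u *] assms by (simp add: radial_L2_def L2_def)
qed

lemma coef_index [simp]: "coef (\<lambda>x. f (index x)) = f"
  by (rule coef_eqI) simp

lemma comp_index_in_H: "seq.l2_seq f \<Longrightarrow> (\<lambda>x. f (index x)) \<in> H"
  by (rule radial_L2_I) auto

lemma coef_lincomb:
  assumes "u \<in> H" "v \<in> H"
  shows "coef (\<lambda>x. a * u x + b * v x) = (\<lambda>n. a * coef u n + b * coef v n)"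
  by (rule coef_eqI) (use radial_L2_D(2)[OF assms(1)] radial_L2_D(2)[OF assms(2)] in eventually_elim, simp)

lemma l2_norm_eq:
  assumes "u \<in> H"
  shows "l2_norm M u = sqrt (seq.norm2 (coef u))"
proof -
  note u = radial_L2_D[OF assms]
  have "(LINT x|M. (cmod (u x))\<^sup>2) = (LINT x|M. (cmod (coef u (index x)))\<^sup>2)"
    by (rule integral_cong_AE) (use u in auto)
  also have "\<dots> = (\<Sum>n. ((1 - r) * r ^ n) *\<^sub>R (cmod (coef u n))\<^sup>2)"
    by (rule integral_index) (use u(3) r in \<open>simp add: seq.l2_seq_def abs_mult\<close>)
  finally show ?thesis
    by (simp add: l2_norm_def seq.norm2_def)
qed

text \<open>Absolute convergence comes from 2|a||b| \<le> |a|^2 + |b|^2. The factors are ordered so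
  that the series is a pairing in the sense of \<open>pairing_resolvent_seq\<close>.\<close>

lemma l2_inner_eq:
  assumes "u \<in> H" "v \<in> H"
  shows "l2_inner M u v = of_real (1 - r) * (\<Sum>n. cnj (coef v n) * of_real (r ^ n) * coef u n)"
proof -
  note u = radial_L2_D[OF assms(1)] and v = radial_L2_D[OF assms(2)]
  have le: "norm (((1 - r) * r ^ n) *\<^sub>R (coef u n * cnj (coef v n)))
      \<le> (1 - r) * r ^ n * (cmod (coef u n))\<^sup>2 + (1 - r) * r ^ n * (cmod (coef v n))\<^sup>2" for n
  proof -
    have "2 * (cmod (coef u n) * cmod (coef v n)) \<le> (cmod (coef u n))\<^sup>2 + (cmod (coef v n))\<^sup>2"
      using sum_squares_bound by (metis mult.assoc)
    then have "cmod (coef u n) * cmod (coef v n) \<le> (cmod (coef u n))\<^sup>2 + (cmod (coef v n))\<^sup>2"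
      using mult_nonneg_nonneg[OF norm_ge_zero norm_ge_zero, of "coef u n" "coef v n"] by linarith
    then have "(1 - r) * r ^ n * (cmod (coef u n) * cmod (coef v n))
        \<le> (1 - r) * r ^ n * ((cmod (coef u n))\<^sup>2 + (cmod (coef v n))\<^sup>2)"
      using r by (intro mult_left_mono) auto
    then show ?thesis
      using r by (simp add: norm_mult distrib_left)
  qed
  have sm: "summable (\<lambda>n. norm (((1 - r) * r ^ n) *\<^sub>R (coef u n * cnj (coef v n))))"
    by (rule summable_comparison_test'[OF summable_add[OF u(3)[unfolded seq.l2_seq_def]
      v(3)[unfolded seq.l2_seq_def]]]) (use le in simp)
  have "l2_inner M u v = (LINT x|M. coef u (index x) * cnj (coef v (index x)))"
    unfolding l2_inner_def
  proof (rule integral_cong_AE)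
    show "AE x in M. u x * cnj (v x) = coef u (index x) * cnj (coef v (index x))"
      using u(2) v(2) by eventually_elim simp
    show "(\<lambda>x. u x * cnj (v x)) \<in> borel_measurable M"
      by (intro borel_measurable_times u(1) borel_measurable_continuous_on[OF _ v(1)] continuous_intros)
  qed measurable
  also have "\<dots> = (\<Sum>n. ((1 - r) * r ^ n) *\<^sub>R (coef u n * cnj (coef v n)))"
    by (rule integral_index[OF sm])
  also have "\<dots> = (\<Sum>n. of_real (1 - r) * (cnj (coef v n) * of_real (r ^ n) * coef u n))"
    by (simp add: scaleR_conv_of_real mult_ac)
  also have "\<dots> = of_real (1 - r) * (\<Sum>n. cnj (coef v n) * of_real (r ^ n) * coef u n)"
  proof (rule suminf_mult)
    have "summable (\<lambda>n. of_real (1 / (1 - r)) * (((1 - r) * r ^ n) *\<^sub>R (coef u n * cnj (coef v n))))"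
      by (intro summable_mult summable_norm_cancel[OF sm])
    then show "summable (\<lambda>n. cnj (coef v n) * of_real (r ^ n) * coef u n)"
      using r by (simp add: scaleR_conv_of_real mult_ac)
  qed
  finally show ?thesis .
qed

lemma ln_abs: "absK x \<le> 1 \<Longrightarrow> ln (absK x) = - (real (index x) * ln q)"
proof (cases "x = 0")
  case False
  assume "absK x \<le> 1"
  with False have "ln (absK x) = ln (r ^ index x)"
    using abs_eq_power_index by simp
  then show ?thesis
    using r q_gt_1 by (simp add: ln_realpow r_def ln_div)
qed simp

text \<open>A smaller absolute value means a larger index, the difference of logarithms is (m - n)
  ln q, and the sphere masses supply (1 - r) r^m; the factors ln q cancel. The point 0 is excluded
  since the integral there is over the empty set, while \<open>index 0 = 0\<close> would give the
  value for the unit sphere.\<close>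

lemma volterra_eq:
  assumes "u \<in> H" and x: "absK x \<le> 1" "x \<noteq> 0"
  shows "volterra_I absK \<mu> u x = - of_real ((1 - r)\<^sup>2) * volt_seq r (coef u) (index x)"
proof -
  note u = radial_L2_D[OF assms(1)]
  note bdd = seq.l2_seq_bounded_by[OF u(3)]
  define A where "A = {y. absK y < absK x}"
  have "open A"
    unfolding A_def open_iff_abs
  proof (intro ballI exI conjI allI impI)
    show "0 < absK x"
      using x abs_pos by simp
    fix y z assume "y \<in> {y. absK y < absK x}" "absK (z - y) < absK x"
    then show "z \<in> {y. absK y < absK x}"
      using abs_ultrametric[of "z - y" y] by auto
  qed
  moreover have A01: "A \<subseteq> disc 0 0"
    using x by (auto simp: A_def disc_def)
  ultimately have A: "A \<in> sets M"
    by (simp add: sets_M sets_haar)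
  \<comment> \<open>Truncated subtraction in \<open>m - index x\<close> takes over the role of the
    indicator of A.\<close>
  define G where "G m = of_real (real (m - index x) * ln q) * coef u m" for m
  \<comment> \<open>Since A lies in O, the indicator of O may be inserted, and the integral passes
    to the measure restricted to O.\<close>
  have "(LINT y:A|\<mu>. complex_of_real (ln (absK x) - ln (absK y)) * u y)
      = (LINT y|\<mu>. indicator (disc 0 0) y *\<^sub>R
          (indicator A y *\<^sub>R (complex_of_real (ln (absK x) - ln (absK y)) * u y)))"
    unfolding set_lebesgue_integral_def using A01
    by (intro Bochner_Integration.integral_cong refl) (auto simp: indicator_def)
  also have "\<dots> = (LINT y|M. indicator A y *\<^sub>R (complex_of_real (ln (absK x) - ln (absK y)) * u y))"
    unfolding integers_measure_def ring_of_integers_eq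
    by (rule integral_restrict_space[symmetric]) simp
  also have "\<dots> = (LINT y|M. indicator A y *\<^sub>R
      (complex_of_real (real (index y) * ln q - real (index x) * ln q) * u y))"
    using x by (intro Bochner_Integration.integral_cong refl) (auto simp: ln_abs in_space_M)
  also have "\<dots> = (LINT y|M. G (index y))"
  proof (rule integral_cong_AE)
    show "(\<lambda>y. indicator A y *\<^sub>R (complex_of_real (real (index y) * ln q - real (index x) * ln q) * u y))
        \<in> borel_measurable M"
      using A u(1) by measurable
    show "AE y in M. indicator A y *\<^sub>R
        (complex_of_real (real (index y) * ln q - real (index x) * ln q) * u y) = G (index y)"
      using u(2) AE_M_abs
    proof eventually_elim
      case (elim y)
      have "y \<in> A \<longleftrightarrow> index x < index y"
        using elim x r by (simp add: A_def abs_eq_power_index[OF x(2,1)] power_strict_decreasing_iff)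
      then show ?case
        using elim by (auto simp: G_def indicator_def of_nat_diff left_diff_distrib)
    qed
  qed measurable
  also have "\<dots> = (\<Sum>m. ((1 - r) * r ^ m) *\<^sub>R G m)"
  proof (rule integral_index)
    have "summable (\<lambda>m. (1 - r) * ln q * cmod (of_nat (m - index x) * of_real (r ^ m) * coef u m))"
      by (intro summable_mult seq.volt_seq_summable[OF bdd])
    then show "summable (\<lambda>m. norm (((1 - r) * r ^ m) *\<^sub>R G m))"
      using r q_gt_1 by (simp add: G_def norm_mult norm_power mult_ac)
  qed
  also have "\<dots> = (\<Sum>m. of_real ((1 - r) * ln q) * (of_nat (m - index x) * of_real (r ^ m) * coef u m))"
    by (simp add: G_def scaleR_conv_of_real mult_ac)
  also have "\<dots> = of_real ((1 - r) * ln q) * volt_seq r (coef u) (index x)"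
    unfolding volt_seq_def
    by (rule suminf_mult[OF summable_norm_cancel[OF seq.volt_seq_summable[OF bdd]]])
  finally have "volterra_I absK \<mu> u x
      = of_real ((1 - q) / (q * ln q) * ((1 - r) * ln q)) * volt_seq r (coef u) (index x)"
    by (simp add: volterra_I_def Let_def A_def flip: q_def)
  also have "(1 - q) / (q * ln q) * ((1 - r) * ln q) = - ((1 - r)\<^sup>2)"
    using q_gt_1 by (simp add: r_def field_simps power2_eq_square)
  finally show ?thesis
    by simp
qed

section \<open>Inversion of the operator pencil on radial functions\<close>

definition shift :: "complex \<Rightarrow> complex" where
  "shift z = - (of_real ((1 - r)\<^sup>2) * z)"

abbreviation pencil :: "complex \<Rightarrow> ('a \<Rightarrow> complex) \<Rightarrow> 'a \<Rightarrow> complex" where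
  "pencil z \<equiv> \<lambda>u x. u x - z * volterra_I absK \<mu> u x"

text \<open>The factor -(1 - r)^2 relating the two operators is absorbed into the parameter: on
  coefficients the pencil is E - \<open>shift z\<close> B.\<close>

lemma AE_pencil:
  assumes "u \<in> H"
  shows "AE x in M. pencil z u x = coef u (index x) - shift z * volt_seq r (coef u) (index x)"
  using radial_L2_D(2)[OF assms] AE_M_nonzero AE_space
  by eventually_elim (use volterra_eq[OF assms] in \<open>simp add: in_space_M shift_def\<close>)

lemma coef_pencil:
  "u \<in> H \<Longrightarrow> coef (pencil z u) = (\<lambda>n. coef u n - shift z * volt_seq r (coef u) n)"
  by (rule coef_eqI) (rule AE_pencil)

definition resolvent :: "complex \<Rightarrow> ('a \<Rightarrow> complex) \<Rightarrow> 'a \<Rightarrow> complex" where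
  "resolvent z u x = resolvent_seq r (shift z) (coef u) (index x)"

lemma resolvent_in_H: "u \<in> H \<Longrightarrow> resolvent z u \<in> H"
  unfolding resolvent_def by (intro comp_index_in_H seq.resolvent_seq_l2 radial_L2_D)

lemma coef_resolvent: "coef (resolvent z u) = resolvent_seq r (shift z) (coef u)"
  unfolding resolvent_def by simp

text \<open>The sequence identities give both compositions almost everywhere, and
  \<open>resolvent_bound\<close> gives boundedness. An inverse thus exists, which gives meaning to
  the choice in \<open>inverse_op\<close>.\<close>

lemma is_inverse_resolvent: "is_inverse_op M H (pencil z) (resolvent z)"
proof -
  note bdd = seq.l2_seq_bounded_by[OF radial_L2_D(3)]
  have "l2_norm M (resolvent z u) \<le> sqrt (seq.resolvent_bound (shift z)) * l2_norm M u" if "u \<in> H" for u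
    using seq.resolvent_seq_l2(2)[OF radial_L2_D(3)[OF that], of "shift z"] that
    by (simp add: l2_norm_eq resolvent_in_H coef_resolvent flip: real_sqrt_mult)
  moreover have "resolvent z (\<lambda>x. a * u x + b * v x) = (\<lambda>x. a * resolvent z u x + b * resolvent z v x)"
    if "u \<in> H" "v \<in> H" for u v a b
    unfolding resolvent_def coef_lincomb[OF that] seq.resolvent_seq_lincomb[OF bdd[OF that(1)] bdd[OF that(2)]] ..
  ultimately have "l2_bounded_op M H (resolvent z)"
    unfolding l2_bounded_op_def l2_eq_def using resolvent_in_H by auto
  moreover have "l2_eq M (pencil z (resolvent z u)) u" if u: "u \<in> H" for u
    unfolding l2_eq_def
    using AE_pencil[OF resolvent_in_H[OF u], of z z] radial_L2_D(2)[OF u]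
  proof eventually_elim
    case (elim x)
    then show ?case
      using seq.volt_seq_resolvent_seq[OF bdd[OF u], of "shift z" "index x"] by (simp add: coef_resolvent)
  qed
  moreover have "l2_eq M (resolvent z (pencil z u)) u" if u: "u \<in> H" for u
    unfolding l2_eq_def using radial_L2_D(2)[OF u]
    by eventually_elim (simp add: resolvent_def coef_pencil u seq.resolvent_seq_left_inverse[OF bdd[OF u]])
  ultimately show ?thesis
    unfolding is_inverse_op_def by blast
qed

text \<open>The chosen inverse need not be \<open>resolvent z\<close> as a function, but its value
  solves the pencil equation, and applying the sequence resolvent to that equation determines its
  coefficients.\<close>

lemma coef_inverse_op:
  assumes "h \<in> H"
  shows "inverse_op M H (pencil z) h \<in> H"
    and "coef (inverse_op M H (pencil z) h) = resolvent_seq r (shift z) (coef h)"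
proof -
  let ?u = "inverse_op M H (pencil z) h"
  have inv: "is_inverse_op M H (pencil z) (inverse_op M H (pencil z))"
    unfolding inverse_op_def by (rule someI[of "is_inverse_op M H (pencil z)", OF is_inverse_resolvent])
  then show u: "?u \<in> H"
    using assms by (auto simp: is_inverse_op_def l2_bounded_op_def)
  have "AE x in M. pencil z ?u x = h x"
    using inv assms by (simp add: is_inverse_op_def l2_eq_def)
  with radial_L2_D(2)[OF assms] have "AE x in M. pencil z ?u x = coef h (index x)"
    by eventually_elim simp
  then have "coef h = (\<lambda>n. coef ?u n - shift z * volt_seq r (coef ?u) n)"
    using coef_pencil[OF u, of z] coef_eqI[of "pencil z ?u" "coef h"] by simp
  then show "coef ?u = resolvent_seq r (shift z) (coef h)"
    using seq.resolvent_seq_left_inverse[OF seq.l2_seq_bounded_by[OF radial_L2_D(3)[OF u]]] by auto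
qed

text \<open>The inner product is a pairing of the conjugated coefficients of g with the Neumann
  series at \<open>shift z\<close>. As \<open>shift z = shift 1 * z\<close>, the powers of
  \<open>shift 1\<close> enter the coefficients and account for the factor (1 - r)^2 in D.\<close>

lemma resolvent_entry_power_series:
  assumes h: "h \<in> H" and g: "g \<in> H" and sm: "summable (\<lambda>m. cmod (coef g m) * sqrt r ^ m)"
  obtains A D c where "0 \<le> A" "0 < D" "\<And>k. cmod (c k) \<le> A * D ^ k * sqrt r ^ (k\<^sup>2)"
    "\<And>z. l2_inner M (inverse_op M H (pencil z) h) g = (\<Sum>k. c k * z ^ k)"
proof -
  define B where "B = sqrt (seq.norm2 (coef h) / (1 - r))"
  have B: "seq.bounded_by B (coef h)"
    unfolding B_def by (intro seq.l2_seq_bounded_by radial_L2_D h)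
  define p where "p k = (\<Sum>m. cnj (coef g m) * of_real (r ^ m) * (volt_seq r ^^ k) (coef h) m)" for k
  define S where "S = (\<Sum>m. cmod (cnj (coef g m)) * sqrt r ^ m) * B"
  have sm': "summable (\<lambda>m. cmod (cnj (coef g m)) * sqrt r ^ m)"
    using sm by simp
  have p: "cmod (p k) \<le> S * seq.C ^ k * sqrt r ^ (k\<^sup>2)" for k
    unfolding p_def S_def by (rule seq.pairing_resolvent_seq[OF B sm'])
  \<comment> \<open>At k = 0 the bound reads |p 0| \<le> S.\<close>
  have S: "0 \<le> S"
    using p[of 0] by (simp add: order_trans[OF norm_ge_zero])
  define c where "c k = of_real (1 - r) * (shift 1 ^ k * p k)" for k
  show ?thesis
  proof
    show "0 \<le> (1 - r) * S" "0 < (1 - r)\<^sup>2 * seq.C"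
      using r S seq.C_pos by auto
    show "cmod (c k) \<le> (1 - r) * S * ((1 - r)\<^sup>2 * seq.C) ^ k * sqrt r ^ (k\<^sup>2)" for k
    proof -
      have "cmod (c k) = (1 - r) * ((1 - r)\<^sup>2) ^ k * cmod (p k)"
        using r by (simp add: c_def shift_def norm_mult norm_power del: of_real_diff of_real_power)
      also have "\<dots> \<le> (1 - r) * ((1 - r)\<^sup>2) ^ k * (S * seq.C ^ k * sqrt r ^ (k\<^sup>2))"
        using r by (intro mult_left_mono p) auto
      finally show ?thesis
        by (simp add: power_mult_distrib mult_ac)
    qed
    show "l2_inner M (inverse_op M H (pencil z) h) g = (\<Sum>k. c k * z ^ k)" for z
    proof -
      have "l2_inner M (inverse_op M H (pencil z) h) g = of_real (1 - r) * (\<Sum>k. shift z ^ k * p k)"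
        unfolding l2_inner_eq[OF coef_inverse_op(1)[OF h] g] coef_inverse_op(2)[OF h]
          seq.pairing_resolvent_seq(1)[OF B sm'] p_def ..
      also have "\<dots> = (\<Sum>k. of_real (1 - r) * (shift z ^ k * p k))"
      proof (rule suminf_mult[symmetric])
        show "summable (\<lambda>k. shift z ^ k * p k)"
        proof (rule summable_comparison_test')
          show "summable (\<lambda>k. S * ((cmod (shift z) * seq.C) ^ k * sqrt r ^ (k\<^sup>2)))"
            by (intro summable_mult seq.summable_\<Theta>)
          show "norm (shift z ^ k * p k) \<le> S * ((cmod (shift z) * seq.C) ^ k * sqrt r ^ (k\<^sup>2))" for k
            using mult_left_mono[OF p[of k], of "cmod (shift z) ^ k"]
            by (simp add: norm_mult norm_power power_mult_distrib mult_ac)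
        qed
      qed
      also have "(\<lambda>k. of_real (1 - r) * (shift z ^ k * p k)) = (\<lambda>k. c k * z ^ k)"
      proof -
        have "shift z = shift 1 * z"
          by (simp add: shift_def)
        then show ?thesis
          by (simp add: c_def power_mult_distrib mult_ac)
      qed
      finally show ?thesis .
    qed
  qed
qed

section \<open>Channel functions and entries of the characteristic matrix\<close>

lemma channel_fun_index:
  "absK x \<le> 1 \<Longrightarrow> channel_fun absK \<alpha> x
    = (if \<alpha> = 1 then of_real (q - 1) / (\<i> * of_real (q * ln q)) else - of_real (real (index x) * ln q))"
  by (simp add: channel_fun_def Let_def ln_abs flip: q_def)

lemma summable_index_sqrt: "summable (\<lambda>n. real n * sqrt r ^ n)"
  using sums_of_nat_power[of "sqrt r"] r by (simp add: sums_iff)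

text \<open>Here r^n n^2 is the square of n s^n with s = sqrt r, and one of the two factors is
  bounded because the series of n s^n converges.\<close>

lemma summable_index_squared: "summable (\<lambda>n. (1 - r) * r ^ n * (real n)\<^sup>2)"
proof -
  obtain K where K: "\<And>n. norm (real n * sqrt r ^ n) \<le> K"
    using summable_imp_bounded[OF summable_index_sqrt] by (auto simp: bounded_iff)
  show ?thesis
  proof (rule summable_comparison_test')
    show "summable (\<lambda>n. K * (real n * sqrt r ^ n))"
      by (intro summable_mult summable_index_sqrt)
    show "norm ((1 - r) * r ^ n * (real n)\<^sup>2) \<le> K * (real n * sqrt r ^ n)" for n
    proof -
      have "(1 - r) * r ^ n * (real n)\<^sup>2 \<le> 1 * r ^ n * (real n)\<^sup>2"
        using r by (intro mult_right_mono) auto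
      also have "\<dots> = (real n * sqrt r ^ n) * (real n * sqrt r ^ n)"
        using r by (simp add: power2_eq_square flip: power_mult_distrib)
      also have "\<dots> \<le> K * (real n * sqrt r ^ n)"
        using K[of n] r by (intro mult_right_mono) auto
      finally show ?thesis
        using r by (simp add: abs_mult)
    qed
  qed
qed

text \<open>The coefficients are a constant or -n ln q, so they grow at most linearly against
  geometric weights. The second claim is what the pairing requires; membership in H by itself only
  bounds the terms of that series.\<close>

lemma channel_fun_coef:
  "channel_fun absK \<alpha> \<in> H" "summable (\<lambda>m. cmod (coef (channel_fun absK \<alpha>) m) * sqrt r ^ m)"
proof -
  define f where "f n = (if \<alpha> = 1 then of_real (q - 1) / (\<i> * of_real (q * ln q))
    else - complex_of_real (real n * ln q))" for n
  have eq: "channel_fun absK \<alpha> x = f (index x)" if "x \<in> space M" for x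
    using that channel_fun_index[of x \<alpha>] by (simp add: f_def in_space_M)
  have ae: "AE x in M. channel_fun absK \<alpha> x = f (index x)"
    by (rule AE_I2) (rule eq)
  have coef: "coef (channel_fun absK \<alpha>) = f"
    by (rule coef_eqI[OF ae])
  have l2: "seq.l2_seq f"
  proof (cases "\<alpha> = 1")
    case True
    then show ?thesis
      using r unfolding seq.l2_seq_def f_def
      by (auto intro!: summable_mult summable_mult2 summable_geometric)
  next
    case False
    then have "(\<lambda>n. (1 - r) * r ^ n * (cmod (f n))\<^sup>2) = (\<lambda>n. (1 - r) * r ^ n * (real n)\<^sup>2 * (ln q)\<^sup>2)"
      by (simp add: f_def norm_mult power_mult_distrib mult_ac)
    then show ?thesis
      unfolding seq.l2_seq_def by (simp only: summable_mult2[OF summable_index_squared])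
  qed
  show "channel_fun absK \<alpha> \<in> H"
  proof (rule radial_L2_I[OF _ ae l2])
    show "channel_fun absK \<alpha> \<in> borel_measurable M"
      by (subst measurable_cong[OF eq]) auto
  qed
  show "summable (\<lambda>m. cmod (coef (channel_fun absK \<alpha>) m) * sqrt r ^ m)"
  proof (cases "\<alpha> = 1")
    case True
    then show ?thesis
      unfolding coef f_def using r by (auto intro!: summable_mult summable_geometric)
  next
    case False
    then have "(\<lambda>m. cmod (f m) * sqrt r ^ m) = (\<lambda>m. \<bar>ln q\<bar> * (real m * sqrt r ^ m))"
      by (simp add: f_def norm_mult mult_ac)
    then show ?thesis
      unfolding coef by (simp only: summable_mult[OF summable_index_sqrt])
  qed
qed

text \<open>Multiplication by j from the left interchanges the two rows, so row \<alpha> contains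
  the resolvent of the other channel function.\<close>

lemma char_matrix_inv_entry:
  "char_matrix_inv M H (volterra_I absK \<mu>) h channel_matrix z $ \<alpha> $ \<beta>
    = (if \<alpha> = \<beta> then 1 else 0)
      + \<i> * z * l2_inner M (inverse_op M H (pencil z) (h (if \<alpha> = 1 then 2 else 1))) (h \<beta>)"
  using exhaust_2[of \<alpha>]
  by (auto simp: char_matrix_inv_def Let_def mat_def channel_matrix_def matrix_matrix_mult_def sum_2)

lemma char_matrix_entries:
  defines "W \<equiv> \<lambda>\<alpha> \<beta> z. char_matrix_inv M H (volterra_I absK \<mu>) (channel_fun absK) channel_matrix z $ \<alpha> $ \<beta>"
  shows "W \<alpha> \<beta> holomorphic_on UNIV" "entire_order (W \<alpha> \<beta>) = 0"
proof -
  obtain A D c where c: "0 \<le> A" "0 < D" "\<And>k. cmod (c k) \<le> A * D ^ k * sqrt r ^ (k\<^sup>2)"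
    and W: "\<And>z. l2_inner M (inverse_op M H (pencil z) (channel_fun absK (if \<alpha> = 1 then 2 else 1)))
      (channel_fun absK \<beta>) = (\<Sum>k. c k * z ^ k)"
    by (rule resolvent_entry_power_series[OF channel_fun_coef(1)[of "if \<alpha> = 1 then 2 else 1"]
      channel_fun_coef[of \<beta>]]) (rule that)
  have "W \<alpha> \<beta> z = (if \<alpha> = \<beta> then 1 else 0) + \<i> * z * (\<Sum>k. c k * z ^ k)" for z
    unfolding W_def char_matrix_inv_entry W ..
  from gaussian_coefficients_entire_order_0[OF c(3) c(2) _ _ c(1) this]
  show "W \<alpha> \<beta> holomorphic_on UNIV" "entire_order (W \<alpha> \<beta>) = 0"
    using r by auto
qed

end

theorem theorem3:
  fixes absK :: "'a::{field, t2_space, topological_ab_group_add, topological_semigroup_mult} \<Rightarrow> real"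
    and \<mu> :: "'a measure"
    and W :: "complex \<Rightarrow> complex^2^2"
  assumes "nonarch_local_field absK"
    and "normalized_haar_measure absK \<mu>"
    and W: "\<And>z. W z = char_matrix_inv (integers_measure absK \<mu>) (radial_L2 absK \<mu>)
                    (volterra_I absK \<mu>) (channel_fun absK) channel_matrix z"
  shows "\<forall>\<alpha> \<beta>. (\<lambda>z. W z $ \<alpha> $ \<beta>) holomorphic_on UNIV \<and>
               entire_order (\<lambda>z. W z $ \<alpha> $ \<beta>) = 0"
proof -
  interpret haar_nonarch_field absK \<mu>
    using assms(1,2) by (rule haar_nonarch_field.intro)
  show ?thesis
    unfolding W using char_matrix_entries by simp
qed

end
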